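(* Let $d\in\mathbb N$, $d\ge2$. For every $x\in\mathbb R^d\setminus\{0\}$, every $\epsilon\in(0,1)$ and every $\delta\in(0,\frac d2)$, $$\lim_{s\nearrow1}\Bigl(I_{1-s}*\operatorname{div}\bigl(\mathbb M_\epsilon^2\,\nabla(I_{1-s}*u_{s,\delta})\bigr)\Bigr)(x)=\operatorname{div}\bigl(\mathbb M_\epsilon(x)^2\nabla u_\delta(x)\bigr),$$ where $s$ ranges over $(0,1)$, $u_{s,\delta}(x)=|x|^{s-\delta}\frac{x_1}{|x|}$ and $u_\delta(x)=|x|^{1-\delta}\frac{x_1}{|x|}$.
   Context: For $x\in\mathbb R^d\setminus\{0\}$ write $\widehat x=x/|x|$, $(\widehat x\otimes\widehat x)_{ij}=\widehat x_i\widehat x_j$, and $\mathbb M_\epsilon(x)=(1-\epsilon)\mathrm{Id}+\epsilon\,\widehat x\otimes\widehat x$. The Riesz kernel of order $1-s$ is $$I_{1-s}(x)=\frac{2^{-1+s}\,\Gamma\left(\frac{d-1+s}{2}\right)}{\pi^{d/2}\,\Gamma\left(\frac{1-s}{2}\right)}\,\frac1{|x|^{d-1+s}} .$$ Convolutions with $I_{1-s}$ are understood as principal values, $(I_{1-s}*v)(x)=\lim_{r\to0}\int_{r\le|h|\le1/r}I_{1-s}(h)v(x-h)\,dh$. Divergences and gradients are computed pointwise away from the origin. *)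

theory Defs
  imports "HOL-Analysis.Analysis"
begin

text \<open>The dimension \<open>d\<close> is \<open>CARD('n)\<close>; vectors of $\mathbb{R}^d$ have type \<open>real ^ 'n\<close>.\<close>

definition grad :: "(real ^ 'n \<Rightarrow> real) \<Rightarrow> real ^ 'n \<Rightarrow> real ^ 'n" where
  "grad f x = (THE D. GDERIV f x :> D)"

definition divergence :: "(real ^ 'n \<Rightarrow> real ^ 'n) \<Rightarrow> real ^ 'n \<Rightarrow> real" where
  "divergence F x = trace (jacobian F (at x))"

text \<open>\<open>sgn x\<close> is the unit vector \<open>x / norm x\<close> (and \<open>0\<close> at the origin).\<close>

definition Mmat :: "real \<Rightarrow> real ^ 'n \<Rightarrow> real ^ 'n ^ 'n" where
  "Mmat \<epsilon> x = (1 - \<epsilon>) *\<^sub>R mat 1 + \<epsilon> *\<^sub>R (\<chi> i j. sgn x $ i * sgn x $ j)"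

definition flux :: "real \<Rightarrow> (real ^ 'n \<Rightarrow> real) \<Rightarrow> real ^ 'n \<Rightarrow> real ^ 'n" where
  "flux \<epsilon> w x = (Mmat \<epsilon> x ** Mmat \<epsilon> x) *v grad w x"

text \<open>The divergence-form operator is applied to \<open>w\<close> in the classical sense on the
  punctured space; \<open>grad\<close> and \<open>divergence\<close> are total functions, so this predicate
  records that the derivatives involved really exist.\<close>

definition flux_regular :: "real \<Rightarrow> (real ^ 'n \<Rightarrow> real) \<Rightarrow> bool" where
  "flux_regular \<epsilon> w \<longleftrightarrow>
     (\<forall>y. y \<noteq> 0 \<longrightarrow> w differentiable (at y) \<and> flux \<epsilon> w differentiable (at y))"

text \<open>The Riesz kernel of order \<open>1 - s\<close>.\<close>

definition riesz :: "real \<Rightarrow> real ^ 'n \<Rightarrow> real" where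
  "riesz s x =
     (2 powr (- 1 + s) * Gamma ((real CARD('n) - 1 + s) / 2)
       / (pi powr (real CARD('n) / 2) * Gamma ((1 - s) / 2)))
     * (1 / norm x powr (real CARD('n) - 1 + s))"

definition riesz_trunc :: "real \<Rightarrow> (real ^ 'n \<Rightarrow> real) \<Rightarrow> real ^ 'n \<Rightarrow> real \<Rightarrow> real" where
  "riesz_trunc s v x r =
     (LINT h:{h. r \<le> norm h \<and> norm h \<le> 1 / r}|lborel. riesz s h * v (x - h))"

definition riesz_conv :: "real \<Rightarrow> (real ^ 'n \<Rightarrow> real) \<Rightarrow> real ^ 'n \<Rightarrow> real" where
  "riesz_conv s v x = Lim (at_right 0) (riesz_trunc s v x)"

text \<open>\<open>riesz_conv\<close> is a total function; the principal value exists, and is then equal to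
  \<open>riesz_conv s v x\<close>, under the following condition.\<close>

definition riesz_conv_exists :: "real \<Rightarrow> (real ^ 'n \<Rightarrow> real) \<Rightarrow> real ^ 'n \<Rightarrow> bool" where
  "riesz_conv_exists s v x \<longleftrightarrow>
     (\<forall>r>0. set_integrable lborel {h. r \<le> norm h \<and> norm h \<le> 1 / r}
              (\<lambda>h. riesz s h * v (x - h))) \<and>
     (\<exists>L. (riesz_trunc s v x \<longlongrightarrow> L) (at_right 0))"

text \<open>$|x|^a \, x_k / |x|$; the index \<open>k\<close> is the label of the first coordinate, since an
  abstract finite index type has no distinguished element.\<close>

definition upow :: "'n \<Rightarrow> real \<Rightarrow> real ^ 'n \<Rightarrow> real" where
  "upow k a x = norm x powr a * (x $ k / norm x)"

end

theory Submission
  imports Defs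
begin

text \<open>
  Every function \<open>|x|\<^sup>a x\<^sub>k / |x|\<close> is, up to a scalar, reproduced by all the operators involved.
  Averaging the principal value over \<open>h\<close> and \<open>-h\<close> turns it into an absolutely convergent integral,
  which by homogeneity and invariance under orthogonal maps equals
  \<open>c(s,a) |x|\<^sup>b x\<^sub>k / |x|\<close> with \<open>b = a + 1 - s\<close>. So the first convolution produces a multiple of
  \<open>u\<^sub>\<delta>\<close>, the differential operator maps it to a multiple of the function of degree \<open>-1 - \<delta>\<close>,
  and the second convolution again only contributes a factor. Both factors tend to \<open>1\<close> as \<open>s\<close>
  tends to \<open>1\<close>: the constant of the kernel is of order \<open>1 - s\<close>, so only the singularity of the
  kernel at the origin survives in the limit, and its contribution is an explicit radial integral.
\<close>

subsection \<open>Orthogonal maps and radial integrals\<close>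

text \<open>The uniqueness argument for Haar measure: with \<open>B\<close> the unit ball, the integral of
  \<open>indicator A (y + f x) * indicator B y\<close> over both variables factorises in either order,
  because \<open>f\<close> preserves balls.\<close>

lemma distr_orthogonal_lborel:
  fixes f :: "'a::euclidean_space \<Rightarrow> 'a"
  assumes f: "orthogonal_transformation f"
  shows "distr lborel borel f = lborel"
proof (rule measure_eqI)
  have lin: "linear f" using f by (rule orthogonal_transformation_linear)
  then have [measurable]: "f \<in> borel_measurable borel"
    by (intro borel_measurable_continuous_onI linear_continuous_on) (simp add: linear_linear)
  have tr: "distr lborel borel ((+) c) = (lborel :: 'a measure)" for c
    using lborel_affine[of 1 c] by (simp add: density_1)
  have shift: "(\<integral>\<^sup>+x. g (c + x) \<partial>lborel) = (\<integral>\<^sup>+x. g x \<partial>lborel)"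
    if [measurable]: "g \<in> borel_measurable borel" for g :: "'a \<Rightarrow> ennreal" and c
    by (subst (2) tr[of c, symmetric]) (simp add: nn_integral_distr)
  fix A :: "'a set" assume "A \<in> sets (distr lborel borel f)"
  then have A[measurable]: "A \<in> sets borel" by simp
  define B :: "'a set" where "B = cball 0 1"
  have [measurable]: "B \<in> sets borel" by (simp add: B_def)
  let ?I = "\<integral>\<^sup>+y. \<integral>\<^sup>+x. indicator A (y + f x) * indicator B y \<partial>lborel \<partial>(lborel :: 'a measure)"
  have "?I = (\<integral>\<^sup>+y. emeasure (distr lborel borel f) A * indicator B y \<partial>lborel)"
  proof (intro nn_integral_cong)
    fix y :: 'a
    \<comment> \<open>Writing \<open>y\<close> as \<open>f c\<close> moves the translation inside
      \<open>f\<close>, where translation invariance of Lebesgue measure absorbs it.\<close>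
    obtain c where c: "f c = y" using orthogonal_transformation_surj[OF f] by (metis surjD)
    have "(\<integral>\<^sup>+x. indicator A (y + f x) * indicator B y \<partial>lborel)
        = (\<integral>\<^sup>+x. indicator A (f (c + x)) \<partial>lborel) * indicator B y"
      by (simp add: nn_integral_multc c linear_add[OF lin])
    also have "(\<integral>\<^sup>+x. indicator A (f (c + x)) \<partial>lborel) = (\<integral>\<^sup>+x. indicator A (f x) \<partial>lborel)"
      by (rule shift) simp
    also have "\<dots> = emeasure (distr lborel borel f) A"
      by (simp add: nn_integral_distr flip: nn_integral_indicator)
    finally show "(\<integral>\<^sup>+x. indicator A (y + f x) * indicator B y \<partial>lborel)
        = emeasure (distr lborel borel f) A * indicator B y" .
  qed
  then have 1: "?I = emeasure (distr lborel borel f) A * emeasure lborel B"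
    by (simp add: nn_integral_cmult_indicator)
  have "?I = (\<integral>\<^sup>+x. \<integral>\<^sup>+y. indicator A (y + f x) * indicator B y \<partial>lborel \<partial>lborel)"
    by (rule lborel_pair.Fubini') measurable
  also have "\<dots> = (\<integral>\<^sup>+x. \<integral>\<^sup>+y. indicator A y * indicator B (y - f x) \<partial>lborel \<partial>lborel)"
  proof (rule nn_integral_cong)
    fix x
    show "(\<integral>\<^sup>+y. indicator A (y + f x) * indicator B y \<partial>lborel)
      = (\<integral>\<^sup>+y. indicator A y * indicator B (y - f x) \<partial>lborel)"
      using shift[of "\<lambda>y. indicator A y * indicator B (y - f x)" "f x"]
      by (simp add: add.commute)
  qed
  also have "\<dots> = (\<integral>\<^sup>+y. \<integral>\<^sup>+x. indicator A y * indicator B (y - f x) \<partial>lborel \<partial>lborel)"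
    by (rule lborel_pair.Fubini'[symmetric]) measurable
  also have "\<dots> = (\<integral>\<^sup>+y. indicator A y * emeasure lborel B \<partial>lborel)"
  proof (intro nn_integral_cong)
    fix y :: 'a
    obtain c where c: "f c = y" using orthogonal_transformation_surj[OF f] by (metis surjD)
    have "indicator B (y - f x) = (indicator (cball c 1) x :: ennreal)" for x
      using orthogonal_transformation_norm[OF f, of "c - x"] norm_minus_commute[of y "f x"]
      by (auto simp: B_def indicator_def c linear_diff[OF lin] dist_norm)
    then have "(\<integral>\<^sup>+x. indicator A y * indicator B (y - f x) \<partial>lborel) =
        indicator A y * emeasure lborel (cball c 1)"
      by (simp add: nn_integral_cmult_indicator)
    then show "(\<integral>\<^sup>+x. indicator A y * indicator B (y - f x) \<partial>lborel) =
        indicator A y * emeasure lborel B"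
      by (simp add: B_def emeasure_cball)
  qed
  also have "\<dots> = emeasure lborel A * emeasure lborel B"
    by (simp add: nn_integral_multc)
  finally have "emeasure (distr lborel borel f) A * emeasure lborel B = emeasure lborel A * emeasure lborel B"
    using 1 by simp
  moreover have "emeasure lborel B \<noteq> 0" "emeasure lborel B \<noteq> \<infinity>"
    using unit_ball_vol_pos[of "real DIM('a)"] by (simp_all add: B_def emeasure_cball less_imp_neq[THEN not_sym])
  ultimately show "emeasure (distr lborel borel f) A = emeasure lborel A"
    by (metis (no_types, lifting) ennreal_mult_cancel_left infinity_ennreal_def mult.commute)
qed simp

text \<open>Half-lines form an intersection-stable generator. On \<open>{..a}\<close> the left side
  is the volume of a ball of radius \<open>a\<close>, and the density is the derivative of that
  volume in the radius; polar coordinates thus come without a surface measure.\<close>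

lemma distr_norm_lborel:
  "distr lborel borel (norm :: 'a::euclidean_space \<Rightarrow> real) =
     density lborel (\<lambda>r. ennreal (real DIM('a) * unit_ball_vol DIM('a) * r ^ (DIM('a) - 1)) * indicator {0..} r)"
    (is "?M = ?N")
proof (rule measure_eqI_generator_eq[where E = "range (\<lambda>a. {..a})" and \<Omega> = UNIV and A = "\<lambda>n. {..real n}"])
  let ?d = "DIM('a)"
  let ?g = "\<lambda>r::real. real ?d * unit_ball_vol ?d * r ^ (?d - 1)"
  have M: "emeasure ?M {..a} = (if a < 0 then 0 else ennreal (unit_ball_vol ?d * a ^ ?d))" for a
  proof -
    have "emeasure ?M {..a} = emeasure lborel (cball (0::'a) a)"
      by (subst emeasure_distr) (auto intro!: arg_cong[where f="emeasure lborel"])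
    then show ?thesis by (auto simp: emeasure_cball)
  qed
  fix X :: "real set" assume "X \<in> range (\<lambda>a. {..a})"
  then obtain a where X: "X = {..a}" by auto
  have "emeasure ?N {..a} = (\<integral>\<^sup>+r. ennreal (?g r) * indicator {0..a} r \<partial>lborel)"
    by (subst emeasure_density) (auto intro!: nn_integral_cong split: split_indicator)
  also have "\<dots> = (if a < 0 then 0 else ennreal (unit_ball_vol ?d * a ^ ?d))"
  proof (cases "a < 0")
    case False
    have "(\<integral>\<^sup>+r. ennreal (?g r) * indicator {0..a} r \<partial>lborel)
        = ennreal (unit_ball_vol ?d * a ^ ?d - unit_ball_vol ?d * 0 ^ ?d)"
      using False by (intro nn_integral_FTC_Icc) (auto intro!: derivative_eq_intros)
    then show ?thesis using False by (simp add: zero_power)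
  qed (auto simp: not_le[symmetric])
  finally show "emeasure ?M X = emeasure ?N X" by (simp add: X M)
next
  show "Int_stable (range (\<lambda>a::real. {..a}))"
    by (force simp: Int_stable_def)
  show "sets ?M = sigma_sets UNIV (range (\<lambda>a::real. {..a}))"
    "sets ?N = sigma_sets UNIV (range (\<lambda>a::real. {..a}))"
    by (simp_all add: borel_eq_atMost)
  show "(\<Union>i. {..real i}) = UNIV" using real_arch_simple by auto
  show "emeasure ?M {..real i} \<noteq> \<infinity>" for i
  proof -
    have "emeasure ?M {..real i} = emeasure lborel (cball (0::'a) (real i))"
      by (subst emeasure_distr) (auto intro!: arg_cong[where f="emeasure lborel"])
    then show ?thesis by (auto simp: emeasure_cball)
  qed
qed auto

lemma has_bochner_integral_radial_iff:
  fixes f :: "real \<Rightarrow> real"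
  assumes [measurable]: "f \<in> borel_measurable borel"
  shows "has_bochner_integral lborel (\<lambda>h::'a::euclidean_space. f (norm h)) I \<longleftrightarrow>
    has_bochner_integral lborel
      (\<lambda>r. indicator {0..} r * (real DIM('a) * unit_ball_vol DIM('a) * r ^ (DIM('a) - 1)) * f r) I"
proof -
  let ?g = "\<lambda>r. indicator {0..} r * (real DIM('a) * unit_ball_vol DIM('a) * r ^ (DIM('a) - 1)) :: real"
  have D: "distr lborel borel (norm :: 'a \<Rightarrow> real) = density lborel (\<lambda>r. ennreal (?g r))"
    unfolding distr_norm_lborel by (rule density_cong) (auto split: split_indicator)
  have nn: "?g r \<ge> 0" for r by (auto split: split_indicator)
  have "has_bochner_integral lborel (\<lambda>h::'a. f (norm h)) I \<longleftrightarrow>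
      has_bochner_integral (distr lborel borel (norm :: 'a \<Rightarrow> real)) f I"
    by (simp add: has_bochner_integral_iff integrable_distr_eq integral_distr)
  also have "\<dots> \<longleftrightarrow> has_bochner_integral lborel (\<lambda>r. ?g r * f r) I"
    unfolding D has_bochner_integral_iff using nn
    by (simp add: integrable_density integral_density)
  finally show ?thesis .
qed

text \<open>The exact value matters: for \<open>q = - (d - 1 + s)\<close>, with \<open>d\<close> the
  dimension, it contains the factor \<open>1 / (1 - s)\<close>, which compensates the vanishing
  constant of the Riesz kernel.\<close>

lemma has_bochner_integral_powr_cball:
  fixes q R :: real
  assumes q: "- real DIM('a) < q" and R: "0 < R"
  shows "has_bochner_integral lborel
    (\<lambda>h::'a::euclidean_space. indicator (cball 0 R) h * norm h powr q)
    (real DIM('a) * unit_ball_vol DIM('a) * R powr (real DIM('a) + q) / (real DIM('a) + q))"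
proof -
  let ?d = "DIM('a)"
  let ?c = "real ?d * unit_ball_vol ?d"
  have d: "?d \<ge> 1" by (simp add: DIM_ge_Suc0)
  have "((\<lambda>r. r powr (real ?d - 1 + q)) has_integral (R powr (real ?d - 1 + q + 1) / (real ?d - 1 + q + 1))) {0..R}"
    using q R by (intro has_integral_powr_from_0) auto
  then have "(\<integral>\<^sup>+r. ennreal (indicator {0..R} r * r powr (real ?d - 1 + q)) \<partial>lborel) = ennreal (R powr (real ?d + q) / (real ?d + q))"
    using nn_integral_has_integral_lebesgue[of _ "\<lambda>r. r powr (real ?d - 1 + q)"] by simp
  then have "has_bochner_integral lborel (\<lambda>r. indicator {0..R} r * r powr (real ?d - 1 + q)) (R powr (real ?d + q) / (real ?d + q))"
    using q by (intro has_bochner_integral_nn_integral) auto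
  from has_bochner_integral_mult_right[OF this, of ?c]
  have "has_bochner_integral lborel (\<lambda>r. indicator {0..} r * (?c * r ^ (?d - 1)) * (indicator {..R} r * r powr q))
     (?c * R powr (real ?d + q) / (real ?d + q))"
  proof (rule has_bochner_integral_cong[THEN iffD1, rotated -1])
    fix r :: real
    have "r ^ (?d - 1) * r powr q = r powr (real ?d - 1 + q)" if "r > 0"
      using that d by (simp add: powr_add powr_realpow[symmetric] of_nat_diff)
    \<comment> \<open>By convention \<open>0 powr q = 0\<close>, so the identity also holds at the
      origin, even in dimension one, where \<open>0 ^ (?d - 1)\<close> is \<open>1\<close>.\<close>
    moreover have "0 ^ (?d - 1) * 0 powr q = 0 powr (real ?d - 1 + q)" by simp
    ultimately show "?c * (indicator {0..R} r * r powr (real ?d - 1 + q)) =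
        indicator {0..} r * (?c * r ^ (?d - 1)) * (indicator {..R} r * r powr q)"
      by (cases "r > 0"; cases "r = 0") (auto split: split_indicator)
  qed auto
  then have "has_bochner_integral lborel (\<lambda>h::'a. indicator {..R} (norm h) * norm h powr q)
     (?c * R powr (real ?d + q) / (real ?d + q))"
    by (subst has_bochner_integral_radial_iff) auto
  then show ?thesis
    by (rule has_bochner_integral_cong[THEN iffD1, rotated -1]) (auto split: split_indicator)
qed

lemma integrable_powr_outside_ball:
  fixes q R :: real
  assumes q: "q < - real DIM('a)" and R: "0 < R"
  shows "integrable lborel (\<lambda>h::'a::euclidean_space. indicator (- ball 0 R) h * norm h powr q)"
proof -
  let ?d = "DIM('a)"
  let ?c = "real ?d * unit_ball_vol ?d"
  have d: "?d \<ge> 1" by (simp add: DIM_ge_Suc0)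
  let ?I = "- (R powr (real ?d - 1 + q + 1)) / (real ?d - 1 + q + 1)"
  have "((\<lambda>r. r powr (real ?d - 1 + q)) has_integral ?I) {R..}"
    using q R by (intro has_integral_powr_to_inf) auto
  then have "(\<integral>\<^sup>+r. ennreal (indicator {R..} r * r powr (real ?d - 1 + q)) \<partial>lborel) = ennreal ?I"
    using nn_integral_has_integral_lebesgue[of _ "\<lambda>r. r powr (real ?d - 1 + q)"] by simp
  then have "has_bochner_integral lborel (\<lambda>r. indicator {R..} r * r powr (real ?d - 1 + q)) ?I"
    using q by (intro has_bochner_integral_nn_integral divide_nonpos_neg) auto
  from has_bochner_integral_mult_right[OF this, of ?c]
  have "has_bochner_integral lborel (\<lambda>r. indicator {0..} r * (?c * r ^ (?d - 1)) * (indicator {R..} r * r powr q))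
     (?c * ?I)"
  proof (rule has_bochner_integral_cong[THEN iffD1, rotated -1])
    fix r :: real
    have "r ^ (?d - 1) * r powr q = r powr (real ?d - 1 + q)" if "r > 0"
      using that d by (simp add: powr_add powr_realpow[symmetric] of_nat_diff)
    then show "?c * (indicator {R..} r * r powr (real ?d - 1 + q)) =
        indicator {0..} r * (?c * r ^ (?d - 1)) * (indicator {R..} r * r powr q)"
      using R by (cases "r > 0") (auto split: split_indicator)
  qed auto
  then have "has_bochner_integral lborel (\<lambda>h::'a. indicator {R..} (norm h) * norm h powr q) (?c * ?I)"
    by (subst has_bochner_integral_radial_iff) auto
  then have "integrable lborel (\<lambda>h::'a. indicator {R..} (norm h) * norm h powr q)"
    by (rule integrable.intros)
  then show ?thesis
    by (rule Bochner_Integration.integrable_cong[THEN iffD1, rotated -1]) (auto split: split_indicator)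
qed

subsection \<open>The vector field of components \<open>upow k a\<close>\<close>

text \<open>The field with components \<open>upow k a\<close>. Unlike a single component, the whole
  field commutes with orthogonal maps, which the symmetry arguments use.\<close>

definition homvec :: "real \<Rightarrow> 'a::real_normed_vector \<Rightarrow> 'a" where
  "homvec a y = norm y powr (a - 1) *\<^sub>R y"

lemma upow_eq_homvec: "upow k a y = homvec a y $ k"
  by (cases "y = 0") (simp_all add: upow_def homvec_def powr_diff)

lemma norm_homvec: "norm (homvec a y) = norm y powr a"
  by (cases "y = 0") (simp_all add: homvec_def powr_diff)

lemma homvec_minus [simp]: "homvec a (- y) = - homvec a y"
  by (simp add: homvec_def)

lemma homvec_scaleR: "t > 0 \<Longrightarrow> homvec a (t *\<^sub>R y) = t powr a *\<^sub>R homvec a y"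
  by (simp add: homvec_def powr_mult powr_diff)

lemma homvec_orthogonal:
  "orthogonal_transformation f \<Longrightarrow> homvec a (f y) = f (homvec a y)"
  by (simp add: homvec_def orthogonal_transformation_norm linear_scale orthogonal_transformation_linear)

lemma borel_measurable_homvec [measurable]:
  "homvec a \<in> borel_measurable (borel :: 'a::euclidean_space measure)"
  unfolding homvec_def[abs_def] by measurable

text \<open>With \<open>t = norm (e + h)\<close>, the difference is \<open>t powr (a - 1)\<close>
  times \<open>h\<close> plus \<open>t powr (a - 1) - 1\<close> times \<open>e\<close>. The second
  coefficient is small by the mean value theorem, as \<open>t\<close> is within
  \<open>norm h\<close> of \<open>1\<close>. The constant depends on \<open>a0\<close> only, so the
  bound is uniform in \<open>a\<close>.\<close>

lemma homvec_near_unit: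
  fixes e h :: "'a::euclidean_space"
  assumes a: "a0 \<le> a" "a \<le> 1" and e: "norm e = 1" and h: "norm h \<le> 1/2"
  shows "norm (homvec a (e + h) - e) \<le> (2 powr (1 - a0) + (1 - a0) * 2 powr (2 - a0)) * norm h"
proof -
  define t where "t = norm (e + h)"
  have t: "\<bar>t - 1\<bar> \<le> norm h"
    using norm_triangle_ineq3[of "e + h" e] e by (simp add: t_def)
  then have t12: "t \<ge> 1/2" using h by linarith
  have bound: "u powr b \<le> 2 powr (- c)" if "u \<ge> 1/2" "c \<le> b" "b \<le> 0" for u b c :: real
  proof -
    have "u powr b \<le> (1/2) powr b" using that by (intro powr_mono2') auto
    also have "\<dots> \<le> (1/2) powr c" using that by (intro powr_mono') auto
    also have "\<dots> = 2 powr (- c)" by (simp add: powr_divide powr_minus_divide)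
    finally show ?thesis .
  qed
  have 1: "t powr (a - 1) \<le> 2 powr (1 - a0)"
    using bound[of t "a0 - 1" "a - 1"] t12 a by simp
  have mvt: "norm (t powr (a - 1) - 1 powr (a - 1)) \<le> ((1 - a0) * 2 powr (2 - a0)) * norm (t - 1)"
  proof (rule field_differentiable_bound[of "{1/2..}" "\<lambda>u. u powr (a - 1)" "\<lambda>u. (a - 1) * u powr (a - 2)"])
    show "((\<lambda>u. u powr (a - 1)) has_field_derivative (a - 1) * u powr (a - 2)) (at u within {1/2..})"
      if "u \<in> {1/2..}" for u
      using that by (auto intro!: derivative_eq_intros simp: diff_diff_eq)
    show "norm ((a - 1) * u powr (a - 2)) \<le> (1 - a0) * 2 powr (2 - a0)" if "u \<in> {1/2..}" for u
      using that a bound[of u "a0 - 2" "a - 2"] by (auto simp: abs_mult intro!: mult_mono)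
  qed (use t12 in auto)
  have "homvec a (e + h) - e = t powr (a - 1) *\<^sub>R h + (t powr (a - 1) - 1) *\<^sub>R e"
    by (simp add: homvec_def t_def algebra_simps)
  then have "norm (homvec a (e + h) - e) \<le> t powr (a - 1) * norm h + \<bar>t powr (a - 1) - 1\<bar>"
    using norm_triangle_ineq[of "t powr (a - 1) *\<^sub>R h" "(t powr (a - 1) - 1) *\<^sub>R e"] e by simp
  also have "\<dots> \<le> 2 powr (1 - a0) * norm h + (1 - a0) * 2 powr (2 - a0) * norm h"
  proof (rule add_mono)
    show "t powr (a - 1) * norm h \<le> 2 powr (1 - a0) * norm h"
      by (rule mult_right_mono[OF 1]) simp
    have "\<bar>t powr (a - 1) - 1\<bar> \<le> (1 - a0) * 2 powr (2 - a0) * \<bar>t - 1\<bar>"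
      using mvt by simp
    also have "\<dots> \<le> (1 - a0) * 2 powr (2 - a0) * norm h"
      using t a by (intro mult_left_mono) auto
    finally show "\<bar>t powr (a - 1) - 1\<bar> \<le> (1 - a0) * 2 powr (2 - a0) * norm h" .
  qed
  finally show ?thesis by (simp add: algebra_simps)
qed

text \<open>Oddness and homogeneity of \<open>homvec a\<close> reduce large \<open>h\<close> to the estimate near the unit vector
  \<open>h / norm h\<close>.\<close>

lemma homvec_far:
  fixes e h :: "'a::euclidean_space"
  assumes a: "a0 \<le> a" "a \<le> 1" and e: "norm e = 1" and h: "norm h \<ge> 2"
  shows "norm (homvec a (e + h) + homvec a (e - h))
    \<le> 2 * (2 powr (1 - a0) + (1 - a0) * 2 powr (2 - a0)) * norm h powr (a - 1)"
proof -
  let ?L = "2 powr (1 - a0) + (1 - a0) * 2 powr (2 - a0)"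
  define r where "r = norm h"
  have r: "r \<ge> 2" using h by (simp add: r_def)
  define u w where "u = h /\<^sub>R r" and "w = e /\<^sub>R r"
  have nu: "norm u = 1" and nw: "norm w = 1 / r"
    using r e by (simp_all add: u_def w_def divide_inverse flip: r_def)
  have hu: "h = r *\<^sub>R u" and ew: "e = r *\<^sub>R w" using r by (auto simp: u_def w_def)
  have e1: "e + h = r *\<^sub>R (u + w)" and e2: "e - h = - (r *\<^sub>R (u + - w))"
    by (simp_all add: hu ew algebra_simps)
  \<comment> \<open>Both brackets are perturbations of the unit vector \<open>u\<close> by vectors
    of length \<open>1 / r\<close>, so \<open>r \<ge> 2\<close> is exactly what the near estimate
    asks for.\<close>
  have "homvec a (e + h) + homvec a (e - h)
      = r powr a *\<^sub>R ((homvec a (u + w) - u) - (homvec a (u + - w) - u))"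
    unfolding e1 e2 homvec_minus using r
    by (simp only: homvec_scaleR) (simp add: homvec_scaleR algebra_simps)
  moreover have "norm ((homvec a (u + w) - u) - (homvec a (u + - w) - u)) \<le> ?L * norm w + ?L * norm w"
    using homvec_near_unit[OF a nu, of w] homvec_near_unit[OF a nu, of "- w"] nw r
    by (intro order.trans[OF norm_triangle_ineq4[of "homvec a (u + w) - u"]] add_mono) simp_all
  ultimately have "norm (homvec a (e + h) + homvec a (e - h)) \<le> r powr a * (?L * norm w + ?L * norm w)"
    by (simp add: mult_left_mono)
  also have "\<dots> = 2 * ?L * r powr (a - 1)"
    using r by (simp add: nw powr_diff)
  finally show ?thesis by (simp add: r_def)
qed

section \<open>Affine substitution and the symmetrised integrand\<close>

lemma
  fixes f :: "'a::euclidean_space \<Rightarrow> 'b::{banach, second_countable_topology}"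
  assumes c: "c \<noteq> 0" and f: "integrable lborel f"
  shows lborel_integrable_affine: "integrable lborel (\<lambda>x. f (t + c *\<^sub>R x))" (is ?int)
    and lborel_integral_affine:
      "(\<integral>x. f x \<partial>lborel) = \<bar>c\<bar> ^ DIM('a) *\<^sub>R (\<integral>x. f (t + c *\<^sub>R x) \<partial>lborel)" (is ?eq)
proof -
  have [measurable]: "f \<in> borel_measurable borel" using f by (simp add: borel_measurable_integrable)
  note D = lborel_affine[OF c, of t]
  have "integrable (density (distr lborel borel (\<lambda>x. t + c *\<^sub>R x)) (\<lambda>_. ennreal (\<bar>c\<bar> ^ DIM('a)))) f"
    using f by (simp only: D[symmetric] ennreal_power abs_ge_zero)
  then have "integrable (distr lborel borel (\<lambda>x. t + c *\<^sub>R x)) (\<lambda>x. \<bar>c\<bar> ^ DIM('a) *\<^sub>R f x)"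
    by (subst (asm) integrable_density) auto
  then have "integrable lborel (\<lambda>x. inverse (\<bar>c\<bar> ^ DIM('a)) *\<^sub>R \<bar>c\<bar> ^ DIM('a) *\<^sub>R f (t + c *\<^sub>R x))"
    by - (rule integrable_scaleR_right, simp add: integrable_distr_eq)
  also have "(\<lambda>x. inverse (\<bar>c\<bar> ^ DIM('a)) *\<^sub>R \<bar>c\<bar> ^ DIM('a) *\<^sub>R f (t + c *\<^sub>R x)) = (\<lambda>x. f (t + c *\<^sub>R x))"
    using c by simp
  finally show ?int .
  have "(\<integral>x. f x \<partial>lborel) = (\<integral>x. f x \<partial>density (distr lborel borel (\<lambda>x. t + c *\<^sub>R x)) (\<lambda>_. ennreal (\<bar>c\<bar> ^ DIM('a))))"
    by (simp only: D[symmetric] ennreal_power abs_ge_zero)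
  also have "\<dots> = (\<integral>x. \<bar>c\<bar> ^ DIM('a) *\<^sub>R f x \<partial>distr lborel borel (\<lambda>x. t + c *\<^sub>R x))"
    by (rule integral_density) auto
  also have "\<dots> = \<bar>c\<bar> ^ DIM('a) *\<^sub>R (\<integral>x. f (t + c *\<^sub>R x) \<partial>lborel)"
    by (subst integral_distr) auto
  finally show ?eq .
qed

text \<open>\<open>p\<close> is the decay exponent of the kernel; the factor 1/2 of the average is
  left to \<open>riesz_mult\<close>. At infinity the sum cancels because \<open>homvec a\<close> is
  odd. For nonzero \<open>y\<close> it tends to twice \<open>homvec a y\<close> as \<open>h\<close>
  tends to \<open>0\<close>, and integrability there rests on \<open>p\<close> being less than the
  dimension.\<close>

definition sym_integrand :: "real \<Rightarrow> real \<Rightarrow> 'a::real_normed_vector \<Rightarrow> 'a \<Rightarrow> 'a" where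
  "sym_integrand p a y h = norm h powr (- p) *\<^sub>R (homvec a (y + h) + homvec a (y - h))"

lemma borel_measurable_sym_integrand [measurable]:
  "sym_integrand p a y \<in> borel_measurable (borel :: 'a::euclidean_space measure)"
  unfolding sym_integrand_def[abs_def] by measurable

text \<open>The majorant is the same for all \<open>s\<close> and \<open>a\<close>; only the subtracted term,
  whose integral is explicit, blows up as \<open>s\<close> tends to \<open>1\<close>.\<close>

lemma sym_integrand_dominated:
  fixes e :: "'a::euclidean_space" and a0 \<delta> :: real
  assumes e: "norm e = 1" and a0: "- real DIM('a) < a0" and \<delta>: "0 < \<delta>"
  obtains G where "integrable lborel G"
    and "\<And>s a h. 0 < s \<Longrightarrow> s < 1 \<Longrightarrow> a0 \<le> a \<Longrightarrow> a \<le> s - \<delta> \<Longrightarrow>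
      norm (sym_integrand (real DIM('a) - 1 + s) a e h
        - (2 * (indicator (cball 0 (1/2)) h * norm h powr - (real DIM('a) - 1 + s))) *\<^sub>R e) \<le> G h"
proof -
  define d where "d = real DIM('a)"
  have d1: "d \<ge> 1" using DIM_ge_Suc0[where 'a='a] by (simp add: d_def)
  define L where "L = 2 powr (1 - a0) + (1 - a0) * 2 powr (2 - a0)"
  \<comment> \<open>Three regimes: \<open>G1\<close> bounds the remainder near \<open>h = 0\<close>,
    the shifted \<open>G2\<close> the possible singularities at \<open>h = - e\<close> and
    \<open>h = e\<close>, and \<open>G3\<close> the tail.\<close>
  define G1 G2 G3 :: "'a \<Rightarrow> real" where
    "G1 h = indicator (cball 0 (1/2)) h * norm h powr (1 - d)" and
    "G2 h = indicator (cball 0 3) h * norm h powr a0" and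
    "G3 h = indicator (- ball 0 2) h * norm h powr (- d - \<delta>)" for h
  define G where "G h = 2 * L * G1 h
      + 2 powr d * (G2 (e + h) + G2 (e - h) + 6 * indicator (cball 0 2) h) + 2 * L * G3 h" for h
  have i1: "integrable lborel G1"
    unfolding G1_def d_def
    by (rule integrable.intros, rule has_bochner_integral_powr_cball) auto
  have i2: "integrable lborel G2"
    unfolding G2_def using a0 by (intro integrable.intros[OF has_bochner_integral_powr_cball]) auto
  have i3: "integrable lborel G3"
    unfolding G3_def d_def using \<delta> by (intro integrable_powr_outside_ball) auto
  have i4: "integrable lborel (\<lambda>h::'a. indicator (cball 0 2) h :: real)"
    by (intro integrable_real_indicator) (auto simp: emeasure_cball)
  have i2': "integrable lborel (\<lambda>h. G2 (e + h))" "integrable lborel (\<lambda>h. G2 (e - h))"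
    using lborel_integrable_affine[of 1 G2 e] lborel_integrable_affine[of "-1" G2 e] i2 by simp_all
  have iG: "integrable lborel G"
    unfolding G_def by (intro Bochner_Integration.integrable_add integrable_mult_right i1 i2' i3 i4)
  have G0: "G1 h \<ge> 0" "G2 h \<ge> 0" "G3 h \<ge> 0" for h by (auto simp: G1_def G2_def G3_def)
  show ?thesis
  proof (rule that[OF iG], fold d_def)
    fix s a :: real and h :: 'a
    assume s: "0 < s" "s < 1" and a: "a0 \<le> a" "a \<le> s - \<delta>"
    have a1: "a \<le> 1" using a s \<delta> by simp
    have L0: "L \<ge> 0" using a a1 by (simp add: L_def)
    define p where "p = d - 1 + s"
    have p: "0 < p" "p < d" using d1 s by (auto simp: p_def)
    let ?D = "sym_integrand p a e h - (2 * (indicator (cball 0 (1/2)) h * norm h powr - p)) *\<^sub>R e"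
    consider "norm h \<le> 1/2" | "norm h > 1/2" "norm h < 2" | "norm h \<ge> 2" by linarith
    then have "norm ?D \<le> G h"
    proof cases
      case 1
      \<comment> \<open>The subtracted term removes the value of the sum at \<open>h = 0\<close>, so
        the Lipschitz bound gains one power of \<open>norm h\<close>; the exponent
        \<open>1 - d\<close> is then good for every \<open>s\<close> at once.\<close>
      have "?D = norm h powr - p *\<^sub>R ((homvec a (e + h) - e) + (homvec a (e + - h) - e))"
        using 1 by (simp add: sym_integrand_def algebra_simps flip: scaleR_2)
      moreover have "norm ((homvec a (e + h) - e) + (homvec a (e + - h) - e)) \<le> L * norm h + L * norm h"
        using homvec_near_unit[OF a(1) a1 e, of h] homvec_near_unit[OF a(1) a1 e, of "- h"] 1
        unfolding L_def by (intro order.trans[OF norm_triangle_ineq] add_mono) auto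
      ultimately have "norm ?D \<le> norm h powr - p * (L * norm h + L * norm h)"
        by (simp add: mult_left_mono)
      also have "\<dots> = 2 * L * norm h powr (1 - p)"
        by (cases "h = 0") (auto simp: powr_diff powr_minus_divide)
      also have "\<dots> \<le> 2 * L * norm h powr (1 - d)"
        using 1 p L0 by (intro mult_left_mono powr_mono') auto
      also have "\<dots> = 2 * L * G1 h" using 1 by (simp add: G1_def)
      also have "\<dots> \<le> G h" unfolding G_def using G0 L0 by simp
      finally show ?thesis .
    next
      case 2
      \<comment> \<open>Since \<open>a0 \<le> a\<close> and \<open>a \<le> 1\<close>, the power
        \<open>a0\<close> dominates below \<open>1\<close>, and the identity, at most
        \<open>3\<close> here, dominates above.\<close>
      have pw: "t powr a \<le> t powr a0 + 3" if "0 \<le> t" "t \<le> 3" for t :: real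
      proof (cases "t \<le> 1")
        case True
        then have "t powr a \<le> t powr a0" using that a by (intro powr_mono') auto
        then show ?thesis by simp
      next
        case False
        then have "t powr a \<le> t powr 1" using a1 by (intro powr_mono) auto
        also have "\<dots> \<le> t powr a0 + 3" using that by (simp add: add_increasing)
        finally show ?thesis .
      qed
      have n: "norm (e + h) \<le> 3" "norm (e - h) \<le> 3"
        using norm_triangle_ineq[of e h] norm_triangle_ineq4[of e h] e 2 by auto
      have k: "norm h powr - p \<le> 2 powr d"
      proof -
        have "norm h powr - p \<le> (1/2) powr - p" using p 2 by (intro powr_mono2') auto
        also have "\<dots> = 2 powr p" by (simp add: powr_divide powr_minus_divide)
        also have "\<dots> \<le> 2 powr d" using p by simp
        finally show ?thesis .
      qed
      have "norm ?D = norm h powr - p * norm (homvec a (e + h) + homvec a (e - h))"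
        using 2 by (simp add: sym_integrand_def)
      also have "\<dots> \<le> 2 powr d * (norm (e + h) powr a + norm (e - h) powr a)"
        by (intro mult_mono k order.trans[OF norm_triangle_ineq]) (auto simp: norm_homvec)
      also have "\<dots> \<le> 2 powr d * ((norm (e + h) powr a0 + 3) + (norm (e - h) powr a0 + 3))"
        by (intro mult_left_mono add_mono pw) (use n in auto)
      also have "\<dots> = 2 powr d * (G2 (e + h) + G2 (e - h) + 6 * indicator (cball 0 2) h)"
        using n 2 by (simp add: G2_def)
      also have "\<dots> \<le> G h" unfolding G_def using G0 L0 by simp
      finally show ?thesis .
    next
      case 3
      have "norm ?D = norm h powr - p * norm (homvec a (e + h) + homvec a (e - h))"
        using 3 by (simp add: sym_integrand_def)
      also have "\<dots> \<le> norm h powr - p * (2 * L * norm h powr (a - 1))"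
        using homvec_far[OF a(1) a1 e 3] by (intro mult_left_mono) (auto simp: L_def)
      also have "\<dots> = 2 * L * norm h powr (a - 1 - p)"
        using 3 by (simp add: powr_diff powr_minus_divide)
      \<comment> \<open>The exponent is \<open>a - s - d\<close>, and
        \<open>a \<le> s - \<delta>\<close> supplies the uniform margin \<delta> beyond the critical
        decay \<open>- d\<close>.\<close>
      also have "\<dots> \<le> 2 * L * norm h powr (- d - \<delta>)"
        using 3 a L0 by (intro mult_left_mono powr_mono) (auto simp: p_def)
      also have "\<dots> = 2 * L * G3 h" using 3 by (simp add: G3_def)
      also have "\<dots> \<le> G h" unfolding G_def using G0 L0 by simp
      finally show ?thesis .
    qed
    then show "norm (sym_integrand (d - 1 + s) a e h
        - (2 * (indicator (cball 0 (1/2)) h * norm h powr - (d - 1 + s))) *\<^sub>R e) \<le> G h"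
      by (simp add: p_def)
  qed
qed

lemma sym_integrand_scaleR:
  "t > 0 \<Longrightarrow> sym_integrand p a (t *\<^sub>R y) (t *\<^sub>R h) = t powr (a - p) *\<^sub>R sym_integrand p a y h"
  unfolding sym_integrand_def
  by (simp add: homvec_scaleR powr_mult powr_diff powr_minus_divide
      flip: scaleR_add_right scaleR_diff_right)

lemma sym_integrand_orthogonal:
  assumes "orthogonal_transformation f"
  shows "sym_integrand p a (f y) (f h) = f (sym_integrand p a y h)"
proof -
  have lin: "linear f" using assms by (rule orthogonal_transformation_linear)
  show ?thesis unfolding sym_integrand_def
    by (simp add: homvec_orthogonal[OF assms] orthogonal_transformation_norm[OF assms]
        linear_scale[OF lin] flip: linear_add[OF lin] linear_diff[OF lin])
qed

lemma integrable_sym_integrand: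
  fixes y :: "'a::euclidean_space"
  assumes s: "0 < s" "s < 1" and a: "- real DIM('a) < a" "a < s" and y: "y \<noteq> 0"
  shows "integrable lborel (sym_integrand (real DIM('a) - 1 + s) a y)"
proof -
  let ?p = "real DIM('a) - 1 + s"
  have unit: "integrable lborel (sym_integrand ?p a e)" if e: "norm e = 1" for e :: 'a
  proof -
    let ?S = "\<lambda>h::'a. (2 * (indicator (cball 0 (1/2)) h * norm h powr - ?p)) *\<^sub>R e"
    \<comment> \<open>The uniform majorant is used for one pair only: lower bound \<open>a\<close>
      and margin \<open>s - a\<close> make the pair \<open>(s, a)\<close> admissible.\<close>
    obtain G where G0: "integrable lborel G"
      and G: "\<And>s' a' h. 0 < s' \<Longrightarrow> s' < 1 \<Longrightarrow> a \<le> a' \<Longrightarrow> a' \<le> s' - (s - a) \<Longrightarrow>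
        norm (sym_integrand (real DIM('a) - 1 + s') a' e h
          - (2 * (indicator (cball 0 (1/2)) h * norm h powr - (real DIM('a) - 1 + s'))) *\<^sub>R e) \<le> G h"
      using sym_integrand_dominated[OF e a(1), of "s - a"] a(2) by auto
    have bound: "norm (sym_integrand ?p a e h - ?S h) \<le> norm (G h)" for h
      using G[of s a h] s by auto
    have "integrable lborel (\<lambda>h. sym_integrand ?p a e h - ?S h)"
      by (rule Bochner_Integration.integrable_bound[OF G0]) (measurable, use bound in auto)
    moreover have "integrable lborel ?S"
      using s by (intro integrable_scaleR_left integrable_mult_right integrable.intros[OF has_bochner_integral_powr_cball]) auto
    ultimately have "integrable lborel (\<lambda>h. (sym_integrand ?p a e h - ?S h) + ?S h)"
      by (rule Bochner_Integration.integrable_add)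
    then show ?thesis by simp
  qed
  \<comment> \<open>A general \<open>y\<close> is reduced to its direction by scaling
    \<open>y\<close> and \<open>h\<close> simultaneously.\<close>
  let ?e = "y /\<^sub>R norm y"
  have "integrable lborel (\<lambda>h. norm y powr (a - ?p) *\<^sub>R sym_integrand ?p a ?e (0 + (1 / norm y) *\<^sub>R h))"
    using y by (intro integrable_scaleR_right lborel_integrable_affine unit) auto
  moreover have "norm y powr (a - ?p) *\<^sub>R sym_integrand ?p a ?e (0 + (1 / norm y) *\<^sub>R h) = sym_integrand ?p a y h" for h
    using y by (simp flip: sym_integrand_scaleR)
  ultimately show ?thesis by simp
qed

subsection \<open>Riesz potentials\<close>

definition sym_integral :: "real \<Rightarrow> real \<Rightarrow> 'a::euclidean_space \<Rightarrow> 'a" where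
  "sym_integral p a y = (\<integral>h. sym_integrand p a y h \<partial>lborel)"

text \<open>Scaling \<open>h\<close> by \<open>t\<close> gives a Jacobian on top of the degree
  \<open>a - p\<close> of the integrand. For \<open>p = d - 1 + s\<close> in dimension
  \<open>d\<close> the total degree is \<open>a + 1 - s\<close>: the potential raises homogeneity by
  its order \<open>1 - s\<close>.\<close>

lemma sym_integral_scaleR:
  fixes y :: "'a::euclidean_space"
  assumes t: "t > 0" and int: "integrable lborel (sym_integrand p a (t *\<^sub>R y))"
  shows "sym_integral p a (t *\<^sub>R y) = t powr (a + real DIM('a) - p) *\<^sub>R sym_integral p a y"
proof -
  have "sym_integral p a (t *\<^sub>R y) = t ^ DIM('a) *\<^sub>R (\<integral>h. sym_integrand p a (t *\<^sub>R y) (0 + t *\<^sub>R h) \<partial>lborel)"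
    unfolding sym_integral_def using t lborel_integral_affine[OF _ int, of t 0] by simp
  also have "\<dots> = (t ^ DIM('a) * t powr (a - p)) *\<^sub>R sym_integral p a y"
    using t by (simp add: sym_integrand_scaleR sym_integral_def)
  also have "t ^ DIM('a) * t powr (a - p) = t powr (a + real DIM('a) - p)"
    using t by (simp add: powr_add powr_diff powr_realpow)
  finally show ?thesis .
qed

text \<open>Lebesgue measure is invariant under \<open>f\<close>, so \<open>h\<close> may be
  replaced by \<open>f h\<close>, and the linear map \<open>f\<close> then leaves the
  integral.\<close>

lemma sym_integral_orthogonal:
  fixes f :: "'a::euclidean_space \<Rightarrow> 'a"
  assumes f: "orthogonal_transformation f" and int: "integrable lborel (sym_integrand p a y)"
  shows "sym_integral p a (f y) = f (sym_integral p a y)"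
proof -
  have lin: "bounded_linear f"
    using orthogonal_transformation_linear[OF f] by (simp add: linear_linear)
  then have [measurable]: "f \<in> borel_measurable borel"
    by (intro borel_measurable_continuous_onI linear_continuous_on)
  have "sym_integral p a (f y) = (\<integral>h. sym_integrand p a (f y) h \<partial>distr lborel borel f)"
    by (simp add: sym_integral_def distr_orthogonal_lborel[OF f])
  also have "\<dots> = (\<integral>h. f (sym_integrand p a y h) \<partial>lborel)"
    by (simp add: integral_distr sym_integrand_orthogonal[OF f])
  also have "\<dots> = f (sym_integral p a y)"
    unfolding sym_integral_def by (rule integral_bounded_linear[OF lin int])
  finally show ?thesis .
qed

text \<open>The reflection that fixes the line through \<open>e\<close> and is \<open>-1\<close> on its complement
  also fixes the integral.\<close>

lemma sym_integral_parallel: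
  fixes e :: "'a::euclidean_space"
  assumes e: "norm e = 1" and int: "integrable lborel (sym_integrand p a e)"
  shows "sym_integral p a e = (sym_integral p a e \<bullet> e) *\<^sub>R e"
proof -
  define f where "f z = (2 * (z \<bullet> e)) *\<^sub>R e - z" for z :: 'a
  have ee: "e \<bullet> e = 1" using e by (simp add: norm_eq_1)
  have "orthogonal_transformation f"
    unfolding orthogonal_transformation_def
  proof
    show "linear f"
      by (rule linearI) (simp_all add: f_def algebra_simps)
    show "\<forall>v w. f v \<bullet> f w = v \<bullet> w"
      by (simp add: f_def inner_diff_left inner_diff_right ee inner_commute)
  qed
  moreover have "f e = e" by (simp add: f_def ee scaleR_2)
  ultimately have "sym_integral p a e = f (sym_integral p a e)"
    using sym_integral_orthogonal[of f p a e] int by simp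
  then have "2 *\<^sub>R sym_integral p a e = 2 *\<^sub>R (sym_integral p a e \<bullet> e) *\<^sub>R e"
    by (simp add: f_def scaleR_2 algebra_simps)
  then show ?thesis
    by (metis scaleR_cancel_left zero_neq_numeral)
qed

text \<open>At the axis vector the integral is a multiple of that vector. An orthogonal map carries
  this to any unit vector with the same scalar, and scaling carries it to any nonzero
  \<open>y\<close>.\<close>

lemma sym_integral_eq_homvec:
  fixes y :: "real ^ 'n" and k :: 'n
  assumes s: "0 < s" "s < 1" and a: "- real CARD('n) < a" "a < s" and y: "y \<noteq> 0"
  defines "p \<equiv> real CARD('n) - 1 + s"
  shows "sym_integral p a y = (sym_integral p a (axis k 1) $ k) *\<^sub>R homvec (a + 1 - s) y"
proof -
  have int: "integrable lborel (sym_integrand p a z)" if "z \<noteq> 0" for z :: "real ^ 'n"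
    using integrable_sym_integrand[OF s _ a(2) that] a unfolding p_def by simp
  let ?e = "axis k 1 :: real ^ 'n" and ?u = "y /\<^sub>R norm y"
  have "norm ?u = norm ?e" using y by (simp add: norm_axis_1)
  then obtain f where f: "orthogonal_transformation f" "f ?e = ?u"
    using orthogonal_transformation_exists[of ?e ?u] by metis
  have ne: "?e \<noteq> 0" by (metis norm_axis_1 norm_zero zero_neq_one)
  have "sym_integral p a ?e = (sym_integral p a ?e $ k) *\<^sub>R ?e"
    using sym_integral_parallel[of ?e p a] int[OF ne] by (simp add: norm_axis_1 inner_axis)
  then have 1: "sym_integral p a ?u = (sym_integral p a ?e $ k) *\<^sub>R ?u"
    using sym_integral_orthogonal[OF f(1) int[OF ne]] f
    by (metis linear_scale orthogonal_transformation_linear)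
  have "sym_integral p a y = sym_integral p a (norm y *\<^sub>R ?u)" using y by simp
  also have "\<dots> = norm y powr (a + real DIM(real^'n) - p) *\<^sub>R sym_integral p a ?u"
    using y by (intro sym_integral_scaleR int) auto
  \<comment> \<open>The last \<open>1\<close> undoes the normalisation of \<open>?u\<close>; the
    bracket is the exponent inside \<open>homvec (a + 1 - s)\<close>.\<close>
  also have "a + real DIM(real^'n) - p = (a + 1 - s - 1) + 1" by (simp add: p_def)
  also have "norm y powr \<dots> *\<^sub>R sym_integral p a ?u = (sym_integral p a ?e $ k) *\<^sub>R homvec (a + 1 - s) y"
    unfolding 1 homvec_def powr_add using y by simp
  finally show ?thesis .
qed

section \<open>Kernel constant, multiplier and principal values\<close>

definition riesz_const :: "nat \<Rightarrow> real \<Rightarrow> real" where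
  "riesz_const d s = 2 powr (- 1 + s) * Gamma ((real d - 1 + s) / 2)
       / (pi powr (real d / 2) * Gamma ((1 - s) / 2))"

lemma riesz_eq: "riesz s (x :: real ^ 'n) = riesz_const CARD('n) s * norm x powr - (real CARD('n) - 1 + s)"
  by (simp only: riesz_def riesz_const_def powr_minus_divide)

lemma borel_measurable_riesz [measurable]:
  "riesz s \<in> borel_measurable (borel :: (real ^ 'n) measure)"
  unfolding riesz_eq[abs_def] by measurable

lemma borel_measurable_upow [measurable]:
  fixes k :: "'n::finite"
  shows "upow k a \<in> borel_measurable (borel :: (real ^ 'n) measure)"
proof -
  have [measurable]: "(\<lambda>x. x $ k) \<in> borel_measurable (borel :: (real ^ 'n) measure)"
    by (intro borel_measurable_continuous_onI continuous_intros)
  show ?thesis unfolding upow_def[abs_def] by measurable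
qed

text \<open>The scalar by which the potential acts on \<open>upow k a\<close>; the division by
  \<open>2\<close> is the average over \<open>h\<close> and \<open>- h\<close>.\<close>

definition riesz_mult :: "'n::finite \<Rightarrow> real \<Rightarrow> real \<Rightarrow> real" where
  "riesz_mult k s a = riesz_const CARD('n) s / 2
     * (sym_integral (real CARD('n) - 1 + s) a (axis k 1 :: real ^ 'n) $ k)"

text \<open>On the shell the kernel is in absolute value at most its value at radius
  \<open>r\<close>, and \<open>y - h\<close> stays in a fixed ball, where a singularity of order
  \<open>a\<close> is integrable because \<open>a\<close> exceeds minus the dimension.\<close>

lemma set_integrable_riesz_upow:
  fixes y :: "real ^ 'n" and k :: 'n
  assumes s: "0 < s" "s < 1" and a: "- real CARD('n) < a" and r: "0 < r"
  shows "set_integrable lborel {h. r \<le> norm h \<and> norm h \<le> 1 / r} (\<lambda>h. riesz s h * upow k a (y - h))"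
proof -
  let ?A = "{h :: real ^ 'n. r \<le> norm h \<and> norm h \<le> 1 / r}"
  define R where "R = norm y + 1 / r"
  define p where "p = real CARD('n) - 1 + s"
  have "real CARD('n) \<ge> 1" by (simp add: Suc_leI)
  then have p: "p > 0" using s unfolding p_def by linarith
  have R: "R > 0" using r by (simp add: R_def add_nonneg_pos)
  let ?G = "\<lambda>z::real ^ 'n. indicator (cball 0 R) z * norm z powr a"
  let ?c = "\<bar>riesz_const CARD('n) s\<bar> * r powr - p"
  have [measurable]: "?A \<in> sets borel" by measurable
  have "integrable lborel ?G"
    using a R by (intro integrable.intros[OF has_bochner_integral_powr_cball]) auto
  from lborel_integrable_affine[OF _ this, of "- 1" y]
  have "integrable lborel (\<lambda>h. ?G (y + (- 1) *\<^sub>R h))" by simp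
  from integrable_mult_right[OF this, of ?c]
  have I: "integrable lborel (\<lambda>h. ?c * ?G (y + (- 1) *\<^sub>R h))" by simp
  show ?thesis
    unfolding set_integrable_def
  proof (rule Bochner_Integration.integrable_bound[OF I])
    show "(\<lambda>h. indicat_real ?A h *\<^sub>R (riesz s h * upow k a (y - h))) \<in> borel_measurable lborel"
      by measurable
    show "AE h in lborel. norm (indicat_real ?A h *\<^sub>R (riesz s h * upow k a (y - h))) \<le> norm (?c * ?G (y + (- 1) *\<^sub>R h))"
    proof (rule AE_I2)
      fix h :: "real ^ 'n"
      show "norm (indicat_real ?A h *\<^sub>R (riesz s h * upow k a (y - h))) \<le> norm (?c * ?G (y + (- 1) *\<^sub>R h))"
      proof (cases "h \<in> ?A")
        case True
        then have "norm (y - h) \<le> R" using norm_triangle_ineq4[of y h] by (simp add: R_def)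
        moreover have "norm h powr - p \<le> r powr - p"
          using True r p by (intro powr_mono2') auto
        moreover have "\<bar>homvec a (y - h) $ k\<bar> \<le> norm (y - h) powr a"
          using component_le_norm_cart[of "homvec a (y - h)" k] by (simp add: norm_homvec)
        ultimately show ?thesis
          using True unfolding riesz_eq upow_eq_homvec p_def[symmetric]
          by (simp add: abs_mult mult_mono)
      qed simp
    qed
  qed
qed

text \<open>Averaging over \<open>h\<close> and \<open>- h\<close> makes the integral absolutely convergent at infinity,
  since the kernel is even and \<open>upow k a\<close> is odd.\<close>

lemma riesz_trunc_tendsto:
  fixes y :: "real ^ 'n" and k :: 'n
  assumes s: "0 < s" "s < 1" and a: "- real CARD('n) < a" "a < s" and y: "y \<noteq> 0"
  shows "(riesz_trunc s (upow k a) y \<longlongrightarrow> riesz_mult k s a * upow k (a + 1 - s) y) (at_right 0)"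
proof -
  let ?A = "\<lambda>r. {h :: real ^ 'n. r \<le> norm h \<and> norm h \<le> 1 / r}"
  define p where "p = real CARD('n) - 1 + s"
  let ?S = "\<lambda>h. sym_integrand p a y h $ k"
  let ?c = "riesz_const CARD('n) s"
  have int: "integrable lborel (sym_integrand p a y)"
    using integrable_sym_integrand[OF s _ a(2) y] a unfolding p_def by simp
  have intk: "integrable lborel ?S"
    by (rule integrable_bounded_linear[OF bounded_linear_vec_nth int])
  have [measurable]: "?S \<in> borel_measurable borel"
    using borel_measurable_integrable[OF intk] by simp
  have A[measurable]: "?A r \<in> sets borel" for r by measurable
  \<comment> \<open>The shell is invariant under reflection, so the integral can be averaged with
    its reflected copy before \<open>r\<close> tends to \<open>0\<close>.\<close>
  have trunc: "riesz_trunc s (upow k a) y r = ?c / 2 * (\<integral>h. indicator (?A r) h * ?S h \<partial>lborel)"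
    if r: "r > 0" for r
  proof -
    let ?f = "\<lambda>h. indicator (?A r) h *\<^sub>R (riesz s h * upow k a (y - h))"
    have f: "integrable lborel ?f"
      using set_integrable_riesz_upow[OF s a(1) r, of k y] by (simp add: set_integrable_def)
    have f': "integrable lborel (\<lambda>h. ?f (0 + (- 1) *\<^sub>R h))"
      by (rule lborel_integrable_affine[OF _ f]) simp
    have "(\<integral>h. ?f h \<partial>lborel) = (\<integral>h. ?f (0 + (- 1) *\<^sub>R h) \<partial>lborel)"
      by (subst lborel_integral_affine[OF _ f, of "- 1" 0]) auto
    then have "2 * (\<integral>h. ?f h \<partial>lborel) = (\<integral>h. ?f h + ?f (0 + (- 1) *\<^sub>R h) \<partial>lborel)"
      by (subst Bochner_Integration.integral_add[OF f f']) simp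
    also have "\<dots> = (\<integral>h. ?c * (indicator (?A r) h * ?S h) \<partial>lborel)"
      by (intro Bochner_Integration.integral_cong)
        (auto simp: riesz_eq upow_eq_homvec sym_integrand_def p_def algebra_simps split: split_indicator)
    finally show ?thesis
      by (simp add: riesz_trunc_def set_lebesgue_integral_def)
  qed
  \<comment> \<open>Dominated convergence is applied in \<open>t = 1 / r\<close>, which tends to
    infinity; the inner hole and the outer cutoff disappear together.\<close>
  have "((\<lambda>t. \<integral>h. indicator (?A (inverse t)) h * ?S h \<partial>lborel) \<longlongrightarrow> (\<integral>h. ?S h \<partial>lborel)) at_top"
  proof (rule integral_dominated_convergence_at_top[where w = "\<lambda>h. norm (?S h)"])
    show "integrable lborel (\<lambda>h. norm (?S h))" using intk by simp
    show "\<forall>\<^sub>F t in at_top. AE h in lborel. norm (indicator (?A (inverse t)) h * ?S h) \<le> norm (?S h)"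
      by (auto intro!: always_eventually AE_I2 split: split_indicator)
    show "AE h in lborel. ((\<lambda>t. indicator (?A (inverse t)) h * ?S h) \<longlongrightarrow> ?S h) at_top"
    proof (rule AE_I2)
      fix h :: "real ^ 'n"
      show "((\<lambda>t. indicator (?A (inverse t)) h * ?S h) \<longlongrightarrow> ?S h) at_top"
      \<comment> \<open>For positive \<open>t\<close> the shell misses \<open>h = 0\<close>;
        convergence holds there as well, since \<open>0 powr (- p) = 0\<close> makes the integrand
        vanish.\<close>
      proof (cases "h = 0")
        case False
        have "\<forall>\<^sub>F t in at_top. indicator (?A (inverse t)) h * ?S h = ?S h"
          using eventually_ge_at_top[of "max (norm h) (1 / norm h)"]
        proof eventually_elim
          case (elim t)
          then have "norm h \<le> t" "1 / norm h \<le> t" "0 < norm h" using False by auto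
          then have "t > 0" by linarith
          with \<open>1 / norm h \<le> t\<close> \<open>0 < norm h\<close> have "inverse t \<le> norm h" by (simp add: field_simps)
          with \<open>norm h \<le> t\<close> show ?case by (simp add: inverse_eq_divide)
        qed
        then show ?thesis by (rule tendsto_eventually)
      qed (simp add: sym_integrand_def)
    qed
  qed measurable
  from filterlim_compose[OF this filterlim_inverse_at_top_right]
  have "((\<lambda>r. \<integral>h. indicator (?A r) h * ?S h \<partial>lborel) \<longlongrightarrow> (\<integral>h. ?S h \<partial>lborel)) (at_right 0)"
    by simp
  moreover have "(\<integral>h. ?S h \<partial>lborel) = sym_integral p a y $ k"
    unfolding sym_integral_def by (rule integral_bounded_linear[OF bounded_linear_vec_nth int])
  moreover have "sym_integral p a y $ k = (sym_integral p a (axis k 1) $ k) * upow k (a + 1 - s) y"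
    using sym_integral_eq_homvec[OF s a y, of k] by (simp add: p_def upow_eq_homvec)
  ultimately have "((\<lambda>r. ?c / 2 * (\<integral>h. indicator (?A r) h * ?S h \<partial>lborel)) \<longlongrightarrow>
      ?c / 2 * ((sym_integral p a (axis k 1) $ k) * upow k (a + 1 - s) y)) (at_right 0)"
    by (intro tendsto_mult_left) simp
  then have "((\<lambda>r. ?c / 2 * (\<integral>h. indicator (?A r) h * ?S h \<partial>lborel)) \<longlongrightarrow>
      riesz_mult k s a * upow k (a + 1 - s) y) (at_right 0)"
    by (simp only: riesz_mult_def p_def mult.assoc)
  then show ?thesis
  proof (rule Lim_transform_eventually)
    show "\<forall>\<^sub>F r in at_right 0. ?c / 2 * (\<integral>h. indicator (?A r) h * ?S h \<partial>lborel)
        = riesz_trunc s (upow k a) y r"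
      using eventually_at_right_less[of 0] by eventually_elim (simp only: trunc)
  qed
qed

section \<open>Behaviour of the multiplier as \<open>s\<close> tends to \<open>1\<close>\<close>

lemma riesz_const_eq:
  assumes "s < 1"
  shows "riesz_const d s = (1 - s) * (2 powr (- 1 + s) * Gamma ((real d - 1 + s) / 2)
       / (2 * pi powr (real d / 2) * Gamma ((3 - s) / 2)))"
proof -
  \<comment> \<open>The recursion trades the pole of \<open>Gamma\<close> at \<open>0\<close> for
    the explicit factor \<open>1 - s\<close>, with a cofactor that is regular at
    \<open>s = 1\<close>.\<close>
  have "Gamma ((1 - s) / 2 + 1) = (1 - s) / 2 * Gamma ((1 - s) / 2)"
    using assms by (intro Gamma_plus1) (auto elim!: nonpos_Ints_cases)
  moreover have "(1 - s) / 2 + 1 = (3 - s) / 2" by (simp add: field_simps)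
  ultimately have 3: "Gamma ((3 - s) / 2) = (1 - s) / 2 * Gamma ((1 - s) / 2)" by simp
  have "x / (q * g) = t * (x / (2 * q * (t / 2 * g)))" if "t \<noteq> 0" for x q g t :: real
    using that by simp
  from this[of "1 - s"] show ?thesis
    using assms unfolding riesz_const_def 3 by simp
qed

text \<open>In the second limit the bracket is the integral of the pure power over the ball of
  radius \<open>1/2\<close>. Its \<open>1 / (1 - s)\<close> cancels the zero of the constant; what
  remains tends to the sphere area \<open>d * unit_ball_vol d\<close> times its reciprocal, and the
  radius drops out.\<close>

lemma
  assumes d: "d > 0"
  shows riesz_const_tendsto: "(riesz_const d \<longlongrightarrow> 0) (at_left 1)"
    and riesz_const_ball_tendsto:
      "((\<lambda>s. riesz_const d s * (real d * unit_ball_vol (real d) * (1/2) powr (1 - s) / (1 - s))) \<longlongrightarrow> 1) (at_left 1)"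
proof -
  define A where "A s = 2 powr (- 1 + s) * Gamma ((real d - 1 + s) / 2)
       / (2 * pi powr (real d / 2) * Gamma ((3 - s) / 2))" for s :: real
  have G: "Gamma (real d / 2) > 0" using d by (intro Gamma_real_pos) simp
  have "(A \<longlongrightarrow> 2 powr (- 1 + 1) * Gamma ((real d - 1 + 1) / 2)
       / (2 * pi powr (real d / 2) * Gamma ((3 - 1) / 2))) (at_left 1)"
    unfolding A_def using d
    by (intro tendsto_intros) (auto elim!: nonpos_Ints_cases simp: pos_int_cases)
  then have A: "(A \<longlongrightarrow> Gamma (real d / 2) / (2 * pi powr (real d / 2))) (at_left 1)" by simp
  have ev: "\<forall>\<^sub>F s in at_left 1. s < (1::real)"
    using eventually_at_left_real[of 0 "1::real"] by (rule eventually_mono) auto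
  have "((\<lambda>s. (1 - s) * A s) \<longlongrightarrow> (1 - 1) * (Gamma (real d / 2) / (2 * pi powr (real d / 2)))) (at_left 1)"
    by (intro tendsto_intros A)
  then have "((\<lambda>s. (1 - s) * A s) \<longlongrightarrow> 0) (at_left 1)" by simp
  then show "(riesz_const d \<longlongrightarrow> 0) (at_left 1)"
    by (rule Lim_transform_eventually) (use ev in \<open>eventually_elim, simp add: riesz_const_eq A_def\<close>)
  have "((\<lambda>s. A s * (real d * unit_ball_vol (real d) * (1/2) powr (1 - s))) \<longlongrightarrow>
      Gamma (real d / 2) / (2 * pi powr (real d / 2)) * (real d * unit_ball_vol (real d) * (1/2) powr (1 - 1))) (at_left 1)"
    by (intro tendsto_intros A) auto
  also have "Gamma (real d / 2) / (2 * pi powr (real d / 2)) * (real d * unit_ball_vol (real d) * (1/2) powr (1 - 1)) = 1"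
  proof -
    have "Gamma (real d / 2 + 1) = real d / 2 * Gamma (real d / 2)"
      using d by (intro Gamma_plus1) (auto elim!: nonpos_Ints_cases)
    moreover have "Gamma (real d / 2 + 1) \<noteq> 0"
      by (intro less_imp_neq[THEN not_sym] Gamma_real_pos) simp
    ultimately show ?thesis using less_imp_neq[OF G, THEN not_sym] d by (simp add: unit_ball_vol_def mult.commute)
  qed
  finally show "((\<lambda>s. riesz_const d s * (real d * unit_ball_vol (real d) * (1/2) powr (1 - s) / (1 - s))) \<longlongrightarrow> 1) (at_left 1)"
    by (rule Lim_transform_eventually) (use ev in \<open>eventually_elim, simp add: riesz_const_eq A_def\<close>)
qed

text \<open>The exponent may vary with \<open>s\<close> because the two convolutions use
  \<open>s - \<delta>\<close> and the constant \<open>- 1 - \<delta>\<close>. The error against the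
  explicit ball integral is at most half the absolute kernel constant times an integral independent
  of \<open>s\<close>, hence tends to \<open>0\<close>.\<close>

lemma riesz_mult_tendsto:
  fixes k :: "'n::finite"
  assumes a0: "- real CARD('n) < a0" and \<delta>: "0 < \<delta>"
    and a: "\<forall>\<^sub>F s in at_left 1. a0 \<le> a s \<and> a s \<le> s - \<delta>"
  shows "((\<lambda>s. riesz_mult k s (a s)) \<longlongrightarrow> 1) (at_left 1)"
proof -
  let ?d = "CARD('n)"
  let ?e = "axis k 1 :: real ^ 'n"
  let ?F = "\<lambda>s. real ?d * unit_ball_vol (real ?d) * (1/2) powr (1 - s) / (1 - s)"
  have e: "norm ?e = 1" by (simp add: norm_axis_1)
  then have e0: "?e \<noteq> 0" by (metis norm_zero zero_neq_one)
  obtain G where G0: "integrable lborel G"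
    and G: "\<And>s a h. 0 < s \<Longrightarrow> s < 1 \<Longrightarrow> a0 \<le> a \<Longrightarrow> a \<le> s - \<delta> \<Longrightarrow>
      norm (sym_integrand (real ?d - 1 + s) a ?e h
        - (2 * (indicator (cball 0 (1/2)) h * norm h powr - (real ?d - 1 + s))) *\<^sub>R ?e) \<le> G h"
    using sym_integrand_dominated[OF e _ \<delta>, of a0] a0 by auto
  let ?I = "\<integral>h. G h \<partial>lborel"
  have est: "\<bar>riesz_mult k s (a s) - riesz_const ?d s * ?F s\<bar> \<le> \<bar>riesz_const ?d s\<bar> / 2 * ?I"
    if s: "0 < s" "s < 1" and as: "a0 \<le> a s" "a s \<le> s - \<delta>" for s
  proof -
    define p where "p = real ?d - 1 + s"
    let ?B = "\<lambda>h::real ^ 'n. indicator (cball 0 (1/2)) h * norm h powr - p"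
    let ?W = "sym_integral p (a s) ?e"
    have B: "has_bochner_integral lborel ?B (?F s)"
      using has_bochner_integral_powr_cball[where 'a="real ^ 'n", of "- p" "1/2"] s
      by (simp add: p_def)
    have S: "has_bochner_integral lborel (\<lambda>h. (2 * ?B h) *\<^sub>R ?e) ((2 * ?F s) *\<^sub>R ?e)"
      by (intro has_bochner_integral_scaleR_left has_bochner_integral_mult_right B)
    have int: "integrable lborel (sym_integrand p (a s) ?e)"
      using integrable_sym_integrand[OF s, of "a s" ?e] a0 as \<delta> e0 unfolding p_def by simp
    have "norm (?W - (2 * ?F s) *\<^sub>R ?e) = norm (\<integral>h. sym_integrand p (a s) ?e h - (2 * ?B h) *\<^sub>R ?e \<partial>lborel)"
      using S int unfolding has_bochner_integral_iff sym_integral_def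
      by (subst Bochner_Integration.integral_diff) auto
    also have "\<dots> \<le> ?I"
      by (rule Bochner_Integration.integral_norm_bound_integral)
        (use int S G0 G[OF s as] in \<open>auto simp: has_bochner_integral_iff p_def\<close>)
    finally have "\<bar>(?W - (2 * ?F s) *\<^sub>R ?e) $ k\<bar> \<le> ?I"
      using component_le_norm_cart order.trans by blast
    then have "\<bar>?W $ k - 2 * ?F s\<bar> \<le> ?I" by (simp add: axis_def)
    then have le: "\<bar>riesz_const ?d s / 2\<bar> * \<bar>?W $ k - 2 * ?F s\<bar> \<le> \<bar>riesz_const ?d s / 2\<bar> * ?I"
      by (intro mult_left_mono) auto
    have eq: "riesz_mult k s (a s) - riesz_const ?d s * ?F s = riesz_const ?d s / 2 * (?W $ k - 2 * ?F s)"
      unfolding riesz_mult_def p_def[symmetric] by (simp add: algebra_simps)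
    show ?thesis
      unfolding eq abs_mult using le by (simp only: abs_divide abs_numeral)
  qed
  have ev0: "\<forall>\<^sub>F s in at_left 1. 0 < s \<and> s < (1::real)"
    using eventually_at_left_real[of 0 1] by (simp add: conj_commute)
  have "((\<lambda>s. riesz_mult k s (a s) - riesz_const ?d s * ?F s) \<longlongrightarrow> 0) (at_left 1)"
  proof (rule Lim_null_comparison)
    show "\<forall>\<^sub>F s in at_left 1. norm (riesz_mult k s (a s) - riesz_const ?d s * ?F s) \<le> \<bar>riesz_const ?d s\<bar> / 2 * ?I"
      using ev0 a by eventually_elim (use est in auto)
    have "((\<lambda>s. \<bar>riesz_const ?d s\<bar> / 2 * ?I) \<longlongrightarrow> \<bar>0\<bar> / 2 * ?I) (at_left 1)"
      by (intro tendsto_intros riesz_const_tendsto) auto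
    then show "((\<lambda>s. \<bar>riesz_const ?d s\<bar> / 2 * ?I) \<longlongrightarrow> 0) (at_left 1)" by simp
  qed
  from tendsto_add[OF this riesz_const_ball_tendsto[of ?d]] show ?thesis by simp
qed

text \<open>Agreement off the origin suffices, since \<open>x - h\<close> vanishes only for
  \<open>h = x\<close>, a null set. The values at \<open>0\<close> of potentials and divergences are
  thereby left free.\<close>

lemma riesz_trunc_scale_upow:
  fixes x :: "real ^ 'n" and k :: 'n
  assumes s: "0 < s" "s < 1" and a: "- real CARD('n) < a" and r: "0 < r"
    and v: "\<And>z. z \<noteq> 0 \<Longrightarrow> v z = c * upow k a z"
  shows "set_integrable lborel {h. r \<le> norm h \<and> norm h \<le> 1 / r} (\<lambda>h. riesz s h * v (x - h))" (is ?int)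
    and "riesz_trunc s v x r = c * riesz_trunc s (upow k a) x r" (is ?eq)
proof -
  let ?A = "{h :: real ^ 'n. r \<le> norm h \<and> norm h \<le> 1 / r}"
  have [measurable]: "?A \<in> sets borel" by measurable
  have "v = (\<lambda>z. if z = 0 then v 0 else c * upow k a z)" using v by auto
  also have "\<dots> \<in> borel_measurable borel" by measurable
  finally have [measurable]: "v \<in> borel_measurable borel" .
  have ae: "AE h in lborel. indicator ?A h *\<^sub>R (riesz s h * v (x - h))
      = c * (indicator ?A h *\<^sub>R (riesz s h * upow k a (x - h)))"
    using AE_lborel_singleton[of x] by eventually_elim (simp add: v)
  have "integrable lborel (\<lambda>h. c * (indicator ?A h *\<^sub>R (riesz s h * upow k a (x - h))))"
    using set_integrable_riesz_upow[OF s a r, of k x] unfolding set_integrable_def by simp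
  then show ?int
    unfolding set_integrable_def using ae
    by (subst integrable_cong_AE[OF _ _ ae]) auto
  have "riesz_trunc s v x r = (\<integral>h. c * (indicator ?A h *\<^sub>R (riesz s h * upow k a (x - h))) \<partial>lborel)"
    unfolding riesz_trunc_def set_lebesgue_integral_def
    by (rule integral_cong_AE[OF _ _ ae]) auto
  then show ?eq
    unfolding riesz_trunc_def set_lebesgue_integral_def by simp
qed

text \<open>Existence is stated beside the value: \<open>Lim\<close> is total, so the equation alone
  would not say that the principal value exists.\<close>

lemma riesz_conv_scale_upow:
  fixes x :: "real ^ 'n" and k :: 'n
  assumes s: "0 < s" "s < 1" and a: "- real CARD('n) < a" "a < s" and x: "x \<noteq> 0"
    and v: "\<And>z. z \<noteq> 0 \<Longrightarrow> v z = c * upow k a z"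
  shows "riesz_conv_exists s v x"
    and "riesz_conv s v x = c * (riesz_mult k s a * upow k (a + 1 - s) x)"
proof -
  have "((\<lambda>r. c * riesz_trunc s (upow k a) x r) \<longlongrightarrow> c * (riesz_mult k s a * upow k (a + 1 - s) x)) (at_right 0)"
    by (intro tendsto_mult_left riesz_trunc_tendsto s a x)
  then have lim: "(riesz_trunc s v x \<longlongrightarrow> c * (riesz_mult k s a * upow k (a + 1 - s) x)) (at_right 0)"
  proof (rule Lim_transform_eventually)
    show "\<forall>\<^sub>F r in at_right 0. c * riesz_trunc s (upow k a) x r = riesz_trunc s v x r"
      using eventually_at_right_less[of 0]
      by eventually_elim (rule riesz_trunc_scale_upow(2)[OF s a(1) _ v, symmetric])
  qed
  show "riesz_conv_exists s v x"
    unfolding riesz_conv_exists_def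
    using riesz_trunc_scale_upow(1)[OF s a(1) _ v] lim by blast
  show "riesz_conv s v x = c * (riesz_mult k s a * upow k (a + 1 - s) x)"
    unfolding riesz_conv_def by (rule tendsto_Lim[OF _ lim]) simp
qed

subsection \<open>The differential operator\<close>

lemma Mmat_mult_vec: "Mmat \<epsilon> x *v z = (1 - \<epsilon>) *\<^sub>R z + (\<epsilon> * (sgn x \<bullet> z)) *\<^sub>R sgn x"
proof -
  have "(\<chi> i j. sgn x $ i * sgn x $ j) *v z = (sgn x \<bullet> z) *\<^sub>R sgn x"
    by (simp add: vec_eq_iff matrix_vector_mult_def inner_vec_def sum_distrib_left sum_distrib_right mult_ac)
  then show ?thesis
    by (simp add: Mmat_def matrix_vector_mult_add_rdistrib scaleR_matrix_vector_assoc[symmetric])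
qed

text \<open>\<open>Mmat \<epsilon> x\<close> has eigenvalue \<open>1\<close> on the line of
  \<open>x\<close> and \<open>1 - \<epsilon>\<close> on its orthogonal complement; the formula is
  the spectral decomposition with both eigenvalues squared.\<close>

lemma Mmat_square_mult_vec:
  assumes "x \<noteq> 0"
  shows "(Mmat \<epsilon> x ** Mmat \<epsilon> x) *v z
    = (1 - \<epsilon>)\<^sup>2 *\<^sub>R z + ((1 - (1 - \<epsilon>)\<^sup>2) * (x \<bullet> z) / (norm x)\<^sup>2) *\<^sub>R x"
proof -
  have u: "sgn x \<bullet> sgn x = 1" using assms by (simp add: norm_sgn flip: norm_eq_1)
  have "(Mmat \<epsilon> x ** Mmat \<epsilon> x) *v z = Mmat \<epsilon> x *v (Mmat \<epsilon> x *v z)"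
    by (simp add: matrix_vector_mul_assoc)
  also have "\<dots> = ((1 - \<epsilon>) * (1 - \<epsilon>)) *\<^sub>R z + ((1 - \<epsilon>) * (\<epsilon> * (sgn x \<bullet> z))
      + \<epsilon> * ((1 - \<epsilon>) * (sgn x \<bullet> z) + \<epsilon> * (sgn x \<bullet> z))) *\<^sub>R sgn x"
    by (simp add: Mmat_mult_vec inner_add_right u scaleR_add_right scaleR_add_left)
  also have "\<dots> = (1 - \<epsilon>)\<^sup>2 *\<^sub>R z + ((1 - (1 - \<epsilon>)\<^sup>2) * (sgn x \<bullet> z)) *\<^sub>R sgn x"
    by (intro arg_cong2[where f = "(+)"] arg_cong2[where f = "(*\<^sub>R)"]) (simp_all add: algebra_simps power2_eq_square)
  also have "((1 - (1 - \<epsilon>)\<^sup>2) * (sgn x \<bullet> z)) *\<^sub>R sgn x = ((1 - (1 - \<epsilon>)\<^sup>2) * (x \<bullet> z) / (norm x)\<^sup>2) *\<^sub>R x"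
    by (simp add: sgn_div_norm power2_eq_square divide_inverse mult_ac)
  finally show ?thesis .
qed

section \<open>Explicit gradient, flux and divergence\<close>

lemma has_derivative_norm_powr:
  fixes y :: "'a::real_inner"
  assumes "y \<noteq> 0"
  shows "((\<lambda>y. norm y powr m) has_derivative (\<lambda>h. m * norm y powr (m - 2) * (y \<bullet> h))) (at y)"
proof -
  have "((\<lambda>y. norm y powr m) has_derivative (\<lambda>h. (m * norm y powr (m - 1)) * (h \<bullet> sgn y))) (at y)"
    by (rule has_derivative_compose[OF has_derivative_norm[OF assms], of "\<lambda>t. t powr m", unfolded o_def])
       (use assms in \<open>auto intro!: derivative_eq_intros simp: has_field_derivative_def[symmetric]\<close>)
  moreover have "(m * norm y powr (m - 1)) * (h \<bullet> sgn y) = m * norm y powr (m - 2) * (y \<bullet> h)" for h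
    using assms by (simp add: sgn_div_norm powr_diff power2_eq_square inner_commute divide_inverse mult_ac)
  ultimately show ?thesis by simp
qed

lemma grad_eqI:
  assumes "GDERIV f x :> D"
  shows "grad f x = D"
  unfolding grad_def
proof (rule the_equality[where P = "\<lambda>D. GDERIV f x :> D" and a = D, OF assms])
  fix E assume "GDERIV f x :> E"
  then have "(\<lambda>h. h \<bullet> E) = (\<lambda>h. h \<bullet> D)"
    using assms unfolding gderiv_def by (rule has_derivative_unique)
  then show "E = D" by (metis inner_commute vector_eq_ldot)
qed

lemma trace_matrix: "trace (matrix f) = (\<Sum>i\<in>UNIV. f (axis i 1) $ i)"
  by (simp add: trace_def matrix_def)

lemma divergence_eqI:
  assumes "(F has_derivative F') (at x)"
  shows "divergence F x = (\<Sum>i\<in>UNIV. F' (axis i 1) $ i)"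
  unfolding divergence_def jacobian_def frechet_derivative_at[OF assms, symmetric]
  by (rule trace_matrix)

lemma upow_eq: "upow k a y = norm y powr (a - 1) * y $ k"
  by (simp add: upow_eq_homvec homvec_def)

lemma upow_gderiv:
  assumes "y \<noteq> 0" and w: "\<And>z. z \<noteq> 0 \<Longrightarrow> w z = c * upow k (1 - \<delta>) z"
  shows "GDERIV w y :> c *\<^sub>R (norm y powr (- \<delta>) *\<^sub>R axis k 1 - (\<delta> * norm y powr (- \<delta> - 2) * y $ k) *\<^sub>R y)"
    (is "GDERIV w y :> ?D")
  unfolding gderiv_def
proof (rule has_derivative_transform_within_open[where s = "- {0}"])
  have nth: "((\<lambda>y. y $ k) has_derivative (\<lambda>h. h $ k)) (at y)"
    by (rule bounded_linear_imp_has_derivative[OF bounded_linear_vec_nth])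
  have "((\<lambda>y. c * (norm y powr - \<delta> * y $ k)) has_derivative
      (\<lambda>h. c * (norm y powr - \<delta> * h $ k + (- \<delta> * norm y powr (- \<delta> - 2) * (y \<bullet> h)) * y $ k))) (at y)"
    by (intro has_derivative_mult_right has_derivative_mult has_derivative_norm_powr nth assms(1))
  moreover have "c * (norm y powr - \<delta> * h $ k + (- \<delta> * norm y powr (- \<delta> - 2) * (y \<bullet> h)) * y $ k) = h \<bullet> ?D" for h
    by (simp add: inner_diff_right inner_axis inner_commute algebra_simps)
  ultimately show "((\<lambda>z. c * (norm z powr - \<delta> * z $ k)) has_derivative (\<lambda>h. h \<bullet> ?D)) (at y)"
    by (simp only:)
qed (use assms in \<open>auto simp: upow_eq\<close>)

text \<open>Put \<open>b = (1 - \<epsilon>)\<^sup>2\<close>. The matrix multiplies the gradient by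
  \<open>b\<close> and adds \<open>1 - b\<close> times its radial part, which Euler's identity for
  degree \<open>1 - \<delta>\<close> evaluates. The coefficient along \<open>y\<close> becomes
  \<open>- b * \<delta> + (1 - b) * (1 - \<delta>) = 1 - b - \<delta>\<close>.\<close>

lemma flux_upow:
  assumes "y \<noteq> 0" and w: "\<And>z. z \<noteq> 0 \<Longrightarrow> w z = c * upow k (1 - \<delta>) z"
  shows "flux \<epsilon> w y = c *\<^sub>R (((1 - \<epsilon>)\<^sup>2 * norm y powr (- \<delta>)) *\<^sub>R axis k 1
    + ((1 - (1 - \<epsilon>)\<^sup>2 - \<delta>) * norm y powr (- \<delta> - 2) * y $ k) *\<^sub>R y)"
proof -
  define b where "b = (1 - \<epsilon>)\<^sup>2"
  have n: "norm y powr (- \<delta>) = norm y powr (- \<delta> - 2) * (norm y)\<^sup>2"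
    using assms by (simp add: powr_diff)
  have g: "grad w y = c *\<^sub>R (norm y powr (- \<delta>) *\<^sub>R axis k 1 - (\<delta> * norm y powr (- \<delta> - 2) * y $ k) *\<^sub>R y)"
    by (rule grad_eqI[OF upow_gderiv[OF assms]])
  show ?thesis
    unfolding flux_def Mmat_square_mult_vec[OF assms(1)] g b_def[symmetric] n
    using assms(1) by (simp add: inner_diff_right inner_axis algebra_simps power2_norm_eq_inner flip: scaleR_add_left)
      (use assms(1) in \<open>simp add: field_simps\<close>)
qed

text \<open>The product rule is left unsimplified, so that the trace can be summed term by
  term.\<close>

lemma flux_upow_has_derivative:
  fixes y :: "real ^ 'n" and k :: 'n and \<epsilon> :: real
  assumes "y \<noteq> 0" and w: "\<And>z. z \<noteq> 0 \<Longrightarrow> w z = c * upow k (1 - \<delta>) z"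
  defines "b \<equiv> (1 - \<epsilon>)\<^sup>2"
  shows "(flux \<epsilon> w has_derivative (\<lambda>h. c *\<^sub>R ((b * (- \<delta> * norm y powr (- \<delta> - 2) * (y \<bullet> h))) *\<^sub>R axis k 1
    + (((1 - b - \<delta>) * (norm y powr (- \<delta> - 2) * h $ k + ((- \<delta> - 2) * norm y powr (- \<delta> - 2 - 2) * (y \<bullet> h)) * y $ k)) *\<^sub>R y
    + ((1 - b - \<delta>) * (norm y powr (- \<delta> - 2) * y $ k)) *\<^sub>R h)))) (at y)"
proof (rule has_derivative_transform_within_open[where s = "- {0}"])
  have nth: "((\<lambda>y. y $ k) has_derivative (\<lambda>h. h $ k)) (at y)"
    by (rule bounded_linear_imp_has_derivative[OF bounded_linear_vec_nth])
  note np = has_derivative_norm_powr[OF assms(1)]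
  have "((\<lambda>y. ((1 - b - \<delta>) * (norm y powr (- \<delta> - 2) * y $ k)) *\<^sub>R y) has_derivative
      (\<lambda>h. ((1 - b - \<delta>) * (norm y powr (- \<delta> - 2) * y $ k)) *\<^sub>R h
        + ((1 - b - \<delta>) * (norm y powr (- \<delta> - 2) * h $ k + ((- \<delta> - 2) * norm y powr (- \<delta> - 2 - 2) * (y \<bullet> h)) * y $ k)) *\<^sub>R y)) (at y)"
    by (intro has_derivative_scaleR has_derivative_mult_right has_derivative_mult np nth has_derivative_ident)
  then have 1: "((\<lambda>y. ((1 - b - \<delta>) * (norm y powr (- \<delta> - 2) * y $ k)) *\<^sub>R y) has_derivative
      (\<lambda>h. ((1 - b - \<delta>) * (norm y powr (- \<delta> - 2) * h $ k + ((- \<delta> - 2) * norm y powr (- \<delta> - 2 - 2) * (y \<bullet> h)) * y $ k)) *\<^sub>R y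
        + ((1 - b - \<delta>) * (norm y powr (- \<delta> - 2) * y $ k)) *\<^sub>R h)) (at y)"
    by (simp only: add.commute)
  have 2: "((\<lambda>y. (b * norm y powr (- \<delta>)) *\<^sub>R (axis k 1 :: real ^ 'n)) has_derivative
      (\<lambda>h. (b * (- \<delta> * norm y powr (- \<delta> - 2) * (y \<bullet> h))) *\<^sub>R axis k 1)) (at y)"
    by (intro has_derivative_scaleR_left has_derivative_mult_right np)
  show "((\<lambda>y. c *\<^sub>R ((b * norm y powr (- \<delta>)) *\<^sub>R axis k 1
      + ((1 - b - \<delta>) * (norm y powr (- \<delta> - 2) * y $ k)) *\<^sub>R y)) has_derivative (\<lambda>h. c *\<^sub>R ((b * (- \<delta> * norm y powr (- \<delta> - 2) * (y \<bullet> h))) *\<^sub>R axis k 1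
    + (((1 - b - \<delta>) * (norm y powr (- \<delta> - 2) * h $ k + ((- \<delta> - 2) * norm y powr (- \<delta> - 2 - 2) * (y \<bullet> h)) * y $ k)) *\<^sub>R y
    + ((1 - b - \<delta>) * (norm y powr (- \<delta> - 2) * y $ k)) *\<^sub>R h)))) (at y)"
    by (intro has_derivative_scaleR_right has_derivative_add 1 2)
  show "\<And>x. x \<in> - {0} \<Longrightarrow> c *\<^sub>R ((b * norm x powr - \<delta>) *\<^sub>R axis k 1 +
          ((1 - b - \<delta>) * (norm x powr (- \<delta> - 2) * x $ k)) *\<^sub>R x) = flux \<epsilon> w x"
    using flux_upow[OF _ w, where \<epsilon>=\<epsilon>] by (simp add: b_def mult.assoc)
qed (use assms in auto)

text \<open>The three terms carrying \<open>1 - b - \<delta>\<close> contribute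
  \<open>1 + (- \<delta> - 2) + d = d - 1 - \<delta>\<close> in dimension \<open>d\<close>, and the
  term along the axis contributes \<open>- \<delta> * b\<close>.\<close>

lemma divergence_flux_upow:
  fixes y :: "real ^ 'n" and k :: 'n and \<epsilon> :: real
  assumes "y \<noteq> 0" and w: "\<And>z. z \<noteq> 0 \<Longrightarrow> w z = c * upow k (1 - \<delta>) z"
  defines "b \<equiv> (1 - \<epsilon>)\<^sup>2"
  shows "divergence (flux \<epsilon> w) y
    = c * ((1 - b - \<delta>) * (real CARD('n) - 1 - \<delta>) - \<delta> * b) * upow k (- 1 - \<delta>) y"
proof -
  let ?P = "norm y powr (- \<delta> - 2)"
  have P: "norm y powr (- \<delta> - 2 - 2) * (norm y)\<^sup>2 = ?P"
  proof -
    have "norm y powr (- \<delta> - 2 - 2 + 2) = norm y powr (- \<delta> - 2 - 2) * (norm y)\<^sup>2"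
      using assms(1) by (simp only: powr_add powr_numeral norm_ge_zero)
    moreover have "- \<delta> - 2 - 2 + 2 = - \<delta> - 2" by simp
    ultimately show ?thesis by (simp only:)
  qed
  have ax: "y \<bullet> axis i 1 = y $ i" for i by (simp add: inner_axis)
  have s1: "(\<Sum>i\<in>UNIV. (y \<bullet> axis i 1) * (axis k 1 :: real ^ 'n) $ i) = y $ k"
  proof -
    have "(\<Sum>i\<in>UNIV. y $ i * (axis k 1 :: real ^ 'n) $ i) = y \<bullet> axis k 1"
      by (simp only: inner_vec_def inner_real_def)
    then show ?thesis by (simp only: ax)
  qed
  have s2: "(\<Sum>i\<in>UNIV. (axis i 1 :: real ^ 'n) $ k * y $ i) = y $ k"
    by (simp add: axis_def if_distrib if_distribR sum.delta cong: if_cong)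
  have s3: "(\<Sum>i\<in>UNIV. (y \<bullet> axis i 1) * y $ i) = (norm y)\<^sup>2"
    unfolding ax by (simp only: power2_norm_eq_inner inner_vec_def inner_real_def)
  have s4: "(\<Sum>i\<in>UNIV. (axis i 1 :: real ^ 'n) $ i) = real CARD('n)"
    by (simp add: axis_def)
  have "divergence (flux \<epsilon> w) y = (\<Sum>i\<in>UNIV.
      - c * b * \<delta> * ?P * ((y \<bullet> axis i 1) * (axis k 1 :: real ^ 'n) $ i)
      + c * (1 - b - \<delta>) * ?P * ((axis i 1 :: real ^ 'n) $ k * y $ i)
      + c * (1 - b - \<delta>) * (- \<delta> - 2) * norm y powr (- \<delta> - 2 - 2) * y $ k * ((y \<bullet> axis i 1) * y $ i)
      + c * (1 - b - \<delta>) * ?P * y $ k * (axis i 1 :: real ^ 'n) $ i)"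
    by (rule trans[OF divergence_eqI[OF flux_upow_has_derivative[OF assms(1) w, of \<epsilon>, folded b_def]]], assumption)
      (intro sum.cong, auto simp: algebra_simps)
  also have "\<dots> = - c * b * \<delta> * ?P * y $ k
      + c * (1 - b - \<delta>) * ?P * y $ k
      + c * (1 - b - \<delta>) * (- \<delta> - 2) * norm y powr (- \<delta> - 2 - 2) * y $ k * (norm y)\<^sup>2
      + c * (1 - b - \<delta>) * ?P * y $ k * real CARD('n)"
    by (simp only: sum.distrib sum_distrib_left[symmetric] s1 s2 s3 s4)
  also have "\<dots> = c * ((1 - b - \<delta>) * (real CARD('n) - 1 - \<delta>) - \<delta> * b) * (?P * y $ k)"
    unfolding P[symmetric] by (simp add: algebra_simps)
  also have "?P * y $ k = upow k (- 1 - \<delta>) y" by (simp add: upow_eq algebra_simps)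
  finally show ?thesis .
qed

lemma flux_regular_upow:
  fixes k :: "'n::finite"
  assumes w: "\<And>z :: real ^ 'n. z \<noteq> 0 \<Longrightarrow> w z = c * upow k (1 - \<delta>) z"
  shows "flux_regular \<epsilon> w"
  unfolding flux_regular_def
proof (intro allI impI conjI)
  fix y :: "real ^ 'n" assume y: "y \<noteq> 0"
  show "w differentiable (at y)"
    using upow_gderiv[OF y w] unfolding gderiv_def by (rule differentiableI)
  show "flux \<epsilon> w differentiable (at y)"
    using flux_upow_has_derivative[OF y w] by (rule differentiableI)
qed

section \<open>Passage to the limit in the composed operators\<close>

theorem theorem5p6:
  fixes x :: "real ^ 'n" and k :: 'n and \<epsilon> \<delta> :: real
  assumes "CARD('n) \<ge> 2" and "x \<noteq> 0"
    and "0 < \<epsilon>" and "\<epsilon> < 1"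
    and "0 < \<delta>" and "\<delta> < real CARD('n) / 2"
  shows "(\<forall>s\<in>{0<..<1}.
            (\<forall>y. y \<noteq> 0 \<longrightarrow> riesz_conv_exists s (upow k (s - \<delta>)) y) \<and>
            flux_regular \<epsilon> (riesz_conv s (upow k (s - \<delta>))) \<and>
            riesz_conv_exists s
              (divergence (flux \<epsilon> (riesz_conv s (upow k (s - \<delta>))))) x) \<and>
         flux_regular \<epsilon> (upow k (1 - \<delta>)) \<and>
         ((\<lambda>s. riesz_conv s
                 (divergence (flux \<epsilon> (riesz_conv s (upow k (s - \<delta>))))) x)
            \<longlongrightarrow> divergence (flux \<epsilon> (upow k (1 - \<delta>))) x) (at_left 1)"
proof -
  define b where "b = (1 - \<epsilon>)\<^sup>2"
  \<comment> \<open>\<open>K\<close> is the factor by which the differential operator acts. It is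
    independent of \<open>s\<close>, so all dependence on \<open>s\<close> sits in the two
    multipliers and the final exponent.\<close>
  define K where "K = (1 - b - \<delta>) * (real CARD('n) - 1 - \<delta>) - \<delta> * b"
  let ?w = "\<lambda>s. riesz_conv s (upow k (s - \<delta>)) :: real ^ 'n \<Rightarrow> real"
  have d: "real CARD('n) \<ge> 2" using assms(1) by simp
  \<comment> \<open>The degree \<open>s - \<delta>\<close> raised by \<open>1 - s\<close> is
    \<open>1 - \<delta>\<close> for every \<open>s\<close>, so one computation of the flux serves
    them all.\<close>
  have w: "?w s y = riesz_mult k s (s - \<delta>) * upow k (1 - \<delta>) y" if "0 < s" "s < 1" "y \<noteq> 0" for s y
    using riesz_conv_scale_upow(2)[of s "s - \<delta>" y "upow k (s - \<delta>)" 1 k] that assms(5,6) by simp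
  have v: "divergence (flux \<epsilon> (?w s)) y = riesz_mult k s (s - \<delta>) * K * upow k (- 1 - \<delta>) y"
    if "0 < s" "s < 1" "y \<noteq> 0" for s y
    using divergence_flux_upow[OF that(3) w[OF that(1,2)]] by (simp add: K_def b_def)
  have v1: "divergence (flux \<epsilon> (upow k (1 - \<delta>))) x = K * upow k (- 1 - \<delta>) x"
    using divergence_flux_upow[OF assms(2), of "upow k (1 - \<delta>)" 1] by (simp add: K_def b_def)
  \<comment> \<open>The second potential acts at degree \<open>- 1 - \<delta>\<close>, which exceeds
    minus the dimension \<open>d\<close>: from \<open>\<delta> < d / 2\<close> and
    \<open>d \<ge> 2\<close> follows \<open>1 + \<delta> < d\<close>.\<close>
  have conv: "riesz_conv_exists s (divergence (flux \<epsilon> (?w s))) x"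
    "riesz_conv s (divergence (flux \<epsilon> (?w s))) x
      = riesz_mult k s (s - \<delta>) * K * (riesz_mult k s (- 1 - \<delta>) * upow k (- \<delta> - s) x)"
    if s: "0 < s" "s < 1" for s
    using riesz_conv_scale_upow[OF s _ _ assms(2) v[OF s]] assms(5,6) d s by simp_all
  have "((\<lambda>s. riesz_mult k s (s - \<delta>) * K * (riesz_mult k s (- 1 - \<delta>) * upow k (- \<delta> - s) x))
      \<longlongrightarrow> 1 * K * (1 * upow k (- \<delta> - 1) x)) (at_left 1)"
  proof (intro tendsto_intros)
    have ev: "\<forall>\<^sub>F s in at_left 1. 0 < s \<and> s < (1::real)"
      using eventually_at_left_real[of 0 "1::real"] by (rule eventually_mono) auto
    \<comment> \<open>The exponents \<open>s - \<delta>\<close> stay above \<open>- \<delta>\<close>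
      for positive \<open>s\<close>, and the upper margin holds with equality.\<close>
    show "((\<lambda>s. riesz_mult k s (s - \<delta>)) \<longlongrightarrow> 1) (at_left 1)"
      by (rule riesz_mult_tendsto[of "- \<delta>" \<delta>])
        (use assms(5,6) ev in \<open>auto elim: eventually_mono\<close>)
    show "((\<lambda>s. riesz_mult k s (- 1 - \<delta>)) \<longlongrightarrow> 1) (at_left 1)"
      by (rule riesz_mult_tendsto[of "- 1 - \<delta>" \<delta>])
        (use assms(5,6) d ev in \<open>auto elim: eventually_mono\<close>)
    show "((\<lambda>s. upow k (- \<delta> - s) x) \<longlongrightarrow> upow k (- \<delta> - 1) x) (at_left 1)"
      unfolding upow_def using assms(2) by (intro tendsto_intros) auto
  qed
  then have "((\<lambda>s. riesz_conv s (divergence (flux \<epsilon> (?w s))) x) \<longlongrightarrow> 1 * K * (1 * upow k (- \<delta> - 1) x)) (at_left 1)"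
  proof (rule Lim_transform_eventually)
    show "\<forall>\<^sub>F s in at_left 1. riesz_mult k s (s - \<delta>) * K * (riesz_mult k s (- 1 - \<delta>) * upow k (- \<delta> - s) x)
        = riesz_conv s (divergence (flux \<epsilon> (?w s))) x"
      using eventually_at_left_real[of 0 "1::real"] by (rule eventually_mono) (auto simp: conv)
  qed
  also have "- \<delta> - 1 = - 1 - \<delta>" by simp
  also have "1 * K * (1 * upow k (- 1 - \<delta>) x) = divergence (flux \<epsilon> (upow k (1 - \<delta>))) x"
    unfolding v1 by simp
  finally have lim: "((\<lambda>s. riesz_conv s (divergence (flux \<epsilon> (?w s))) x)
      \<longlongrightarrow> divergence (flux \<epsilon> (upow k (1 - \<delta>))) x) (at_left 1)" .
  have ex: "riesz_conv_exists s (upow k (s - \<delta>)) y" if "0 < s" "s < 1" "y \<noteq> 0" for s and y :: "real ^ 'n"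
    using riesz_conv_scale_upow(1)[of s "s - \<delta>" y "upow k (s - \<delta>)" 1 k] that assms(5,6) by simp
  have reg: "flux_regular \<epsilon> (?w s)" if "0 < s" "s < 1" for s
    by (rule flux_regular_upow[OF w[OF that]])
  have "flux_regular \<epsilon> (upow k (1 - \<delta>) :: real ^ 'n \<Rightarrow> real)"
    by (rule flux_regular_upow[where c = 1 and k = k and \<delta> = \<delta>]) simp
  with lim ex reg conv(1) show ?thesis by simp
qed

end
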